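(* Let $\mathcal{B}$, $\mathcal{D}$ be bicategories. 1. Let $F,G:\mathcal{B}\Rightarrow\mathcal{D}$ be preassignments and let $\theta:F\Rightarrow G$ be a transfer datum in $pre\mathcal{A}ssg(\mathcal{B},\mathcal{D})$. If $G$ has an assignment structure, then $F$ can be uniquely furnished with an assignment structure in such a way that $\theta$ becomes a transfer datum in $\mathcal{A}ssg(\mathcal{B},\mathcal{D})$. 2. Let $F,G$ be assignments and let $\theta:F\Rightarrow G$ be a transfer datum in $\mathcal{A}ssg(\mathcal{B},\mathcal{D})$. If $G$ has a lax functor (respectively pseudofunctor) structure, then $F$ can be uniquely furnished with a lax functor (respectively pseudofunctor) structure in such a way that $\theta$ becomes a pseudo transformation (between lax functors). 3. Consequently, given preassignments $F,G$ and a transfer datum $\theta:F\Rightarrow G$, a lax functor or pseudofunctor structure on $G$ can be transferred backwards to $F$.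
   Context: $\circ$ is vertical composition, $\ast$ horizontal composition (and composition of arrows), $\ast$ binding tighter; associators and unitors are suppressed. A **preassignment** $F:\mathcal{B}\Rightarrow\mathcal{D}$ between bicategories consists of an object $FX$ for each object $X$ and an arrow $Ff:FX\to FY$ for each arrow $f:X\to Y$ of $\mathcal{B}$. An **assignment** is a preassignment together with a 2-cell $F\alpha:Ff\Rightarrow Fg$ for each 2-cell $\alpha:f\Rightarrow g$ such that each $F:\mathcal{B}(X,Y)\to\mathcal{D}(FX,FY)$ is a functor. A **lax functor** is an assignment together with 2-cells $\xi_X:id_{FX}\Rightarrow F(id_X)$ (unit) and $\phi_{f,g}:Fg\ast Ff\Rightarrow F(g\ast f)$ (multiplication), for $f:X\to Y$, $g:Y\to Z$, with $\phi$ natural in $f,g$ and satisfying the unit axioms $\phi\circ(Ff\ast\xi_X)=id_{Ff}$, $\phi\circ(\xi_Y\ast Ff)=id_{Ff}$ and the associativity axiom $\phi_{f,h\ast g}\circ(\phi_{g,h}\ast Ff)=\phi_{g\ast f,h}\circ(Fh\ast\phi_{f,g})$. A **pseudofunctor** is a lax functor with all $\xi,\phi$ invertible. A **lax transformation** $\theta:F\Rightarrow G$ between preassignments is a family of arrows $\theta_X:FX\to GX$ and 2-cells $\theta_f:Gf\ast\theta_X\Rightarrow\theta_Y\ast Ff$ ($f:X\to Y$). Between assignments one requires, for $\alpha:f\Rightarrow g:X\to Y$, (LN0) $\theta_g\circ(G\alpha\ast\theta_X)=(\theta_Y\ast F\alpha)\circ\theta_f$. Between lax functors (or pseudofunctors)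 one requires in addition (LN1) $\theta_X\ast\xi^F_X=\theta_{id_X}\circ(\xi^G_X\ast\theta_X)$ and (LN2) $(\theta_Z\ast\phi^F_{f,g})\circ(\theta_g\ast Ff)\circ(Gg\ast\theta_f)=\theta_{g\ast f}\circ(\phi^G_{f,g}\ast\theta_X)$. It is a **pseudo transformation** if all $\theta_f$ are invertible. A **modification** $\rho:\theta\to\eta$ is a family $\rho_X:\theta_X\Rightarrow\eta_X$ with $(\rho_Y\ast Ff)\circ\theta_f=\eta_f\circ(Gf\ast\rho_X)$ for all $f:X\to Y$. $pre\mathcal{A}ssg(\mathcal{B},\mathcal{D})$, $\mathcal{A}ssg(\mathcal{B},\mathcal{D})$, $lax\mathcal{F}unc(\mathcal{B},\mathcal{D})$, $psd\mathcal{F}unc(\mathcal{B},\mathcal{D})$ are the 2-categories with objects the preassignments, assignments, lax functors, pseudofunctors respectively, arrows the pseudo transformations and 2-cells the modifications. A **transfer datum** $\theta:F\Rightarrow G$ in any of these four 2-categories is a pseudo transformation such that $(\theta_X)_*:\mathcal{D}(W,FX)\to\mathcal{D}(W,GX)$ (postcomposition) is full and faithful for each $W$ in the image of $F$ (i.e. $W=FX'$ for some $X'$) and all objects $X$ of $\mathcal{B}$. *)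

theory Defs
  imports Main
begin

section \<open>Bicategories\<close>

text \<open>
  All composites are written right to left: \<open>g \<star> f\<close> is the composite of \<open>f : X \<rightarrow> Y\<close> and
  \<open>g : Y \<rightarrow> Z\<close>, \<open>\<beta> \<ast> \<alpha>\<close> is the horizontal composite of 2-cells \<open>\<alpha> : f \<Rightarrow> f'\<close> and \<open>\<beta> : g \<Rightarrow> g'\<close>, and
  \<open>\<beta> \<cdot> \<alpha>\<close> is the vertical composite; \<open>\<star>\<close> and \<open>\<ast>\<close> bind tighter than \<open>\<cdot>\<close>. The operations are total functions on the types, but they are
  constrained only on composable elements of the carriers.
\<close>

record ('o, 'a, 'c) bicat =
  Obj :: "'o set"
  Arr :: "'a set"
  Cell :: "'c set"
  src1 :: "'a \<Rightarrow> 'o"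
  trg1 :: "'a \<Rightarrow> 'o"
  src2 :: "'c \<Rightarrow> 'a"
  trg2 :: "'c \<Rightarrow> 'a"
  id1 :: "'o \<Rightarrow> 'a" ("\<one>\<index>")
  id2 :: "'a \<Rightarrow> 'c" ("\<iota>\<index>")
  comp1 :: "'a \<Rightarrow> 'a \<Rightarrow> 'a" (infixr "\<star>\<index>" 75)
  hcomp :: "'c \<Rightarrow> 'c \<Rightarrow> 'c" (infixr "\<ast>\<index>" 75)
  vcomp :: "'c \<Rightarrow> 'c \<Rightarrow> 'c" (infixr "\<cdot>\<index>" 70)
  assoc :: "'a \<Rightarrow> 'a \<Rightarrow> 'a \<Rightarrow> 'c" ("\<a>\<index>")
  lunit :: "'a \<Rightarrow> 'c" ("\<l>\<index>")
  runit :: "'a \<Rightarrow> 'c" ("\<r>\<index>")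

definition hom1 :: "('o, 'a, 'c) bicat \<Rightarrow> 'o \<Rightarrow> 'o \<Rightarrow> 'a set" where
  "hom1 B X Y = {f \<in> Arr B. src1 B f = X \<and> trg1 B f = Y}"

definition hom2 :: "('o, 'a, 'c) bicat \<Rightarrow> 'a \<Rightarrow> 'a \<Rightarrow> 'c set" where
  "hom2 B f g = {\<alpha> \<in> Cell B. src2 B \<alpha> = f \<and> trg2 B \<alpha> = g}"

definition inverse_cells :: "('o, 'a, 'c) bicat \<Rightarrow> 'c \<Rightarrow> 'c \<Rightarrow> bool" where
  "inverse_cells B \<alpha> \<beta> \<longleftrightarrow>
     \<alpha> \<in> Cell B \<and> \<beta> \<in> hom2 B (trg2 B \<alpha>) (src2 B \<alpha>) \<and>
     \<beta> \<cdot>\<^bsub>B\<^esub> \<alpha> = \<iota>\<^bsub>B\<^esub> (src2 B \<alpha>) \<and> \<alpha> \<cdot>\<^bsub>B\<^esub> \<beta> = \<iota>\<^bsub>B\<^esub> (trg2 B \<alpha>)"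

definition iso2 :: "('o, 'a, 'c) bicat \<Rightarrow> 'a \<Rightarrow> 'a \<Rightarrow> 'c set" where
  "iso2 B f g = {\<alpha> \<in> hom2 B f g. \<exists>\<beta>. inverse_cells B \<alpha> \<beta>}"

text \<open>Meaningful only for invertible 2-cells, where the inverse is unique.\<close>
definition inv2 :: "('o, 'a, 'c) bicat \<Rightarrow> 'c \<Rightarrow> 'c" ("inv2\<index>") where
  "inv2\<^bsub>B\<^esub> \<alpha> = (THE \<beta>. inverse_cells B \<alpha> \<beta>)"

abbreviation lwhisker :: "('o, 'a, 'c) bicat \<Rightarrow> 'a \<Rightarrow> 'c \<Rightarrow> 'c" (infixr "\<rhd>\<index>" 75) where
  "f \<rhd>\<^bsub>B\<^esub> \<alpha> \<equiv> \<iota>\<^bsub>B\<^esub> f \<ast>\<^bsub>B\<^esub> \<alpha>"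

abbreviation rwhisker :: "('o, 'a, 'c) bicat \<Rightarrow> 'c \<Rightarrow> 'a \<Rightarrow> 'c" (infixl "\<lhd>\<index>" 75) where
  "\<alpha> \<lhd>\<^bsub>B\<^esub> f \<equiv> \<alpha> \<ast>\<^bsub>B\<^esub> \<iota>\<^bsub>B\<^esub> f"

locale bicategory =
  fixes B :: "('o, 'a, 'c) bicat" (structure)
  assumes src1_Obj: "f \<in> Arr B \<Longrightarrow> src1 B f \<in> Obj B"
    and trg1_Obj: "f \<in> Arr B \<Longrightarrow> trg1 B f \<in> Obj B"
    and src2_Arr: "\<alpha> \<in> Cell B \<Longrightarrow> src2 B \<alpha> \<in> Arr B"
    and trg2_Arr: "\<alpha> \<in> Cell B \<Longrightarrow> trg2 B \<alpha> \<in> Arr B"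
    and globular_src: "\<alpha> \<in> Cell B \<Longrightarrow> src1 B (src2 B \<alpha>) = src1 B (trg2 B \<alpha>)"
    and globular_trg: "\<alpha> \<in> Cell B \<Longrightarrow> trg1 B (src2 B \<alpha>) = trg1 B (trg2 B \<alpha>)"
    and id1_hom: "X \<in> Obj B \<Longrightarrow> \<one> X \<in> hom1 B X X"
    and comp1_hom: "\<lbrakk>f \<in> hom1 B X Y; g \<in> hom1 B Y Z\<rbrakk> \<Longrightarrow> g \<star> f \<in> hom1 B X Z"
    and id2_hom: "f \<in> Arr B \<Longrightarrow> \<iota> f \<in> hom2 B f f"
    and vcomp_hom: "\<lbrakk>\<alpha> \<in> hom2 B f g; \<beta> \<in> hom2 B g h\<rbrakk> \<Longrightarrow> \<beta> \<cdot> \<alpha> \<in> hom2 B f h"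
    and vcomp_id_left: "\<alpha> \<in> hom2 B f g \<Longrightarrow> \<iota> g \<cdot> \<alpha> = \<alpha>"
    and vcomp_id_right: "\<alpha> \<in> hom2 B f g \<Longrightarrow> \<alpha> \<cdot> \<iota> f = \<alpha>"
    and vcomp_assoc: "\<lbrakk>\<alpha> \<in> hom2 B f g; \<beta> \<in> hom2 B g h; \<gamma> \<in> hom2 B h k\<rbrakk>
       \<Longrightarrow> (\<gamma> \<cdot> \<beta>) \<cdot> \<alpha> = \<gamma> \<cdot> (\<beta> \<cdot> \<alpha>)"
    and hcomp_hom: "\<lbrakk>f \<in> hom1 B X Y; g \<in> hom1 B Y Z; \<alpha> \<in> hom2 B f f'; \<beta> \<in> hom2 B g g'\<rbrakk>
       \<Longrightarrow> \<beta> \<ast> \<alpha> \<in> hom2 B (g \<star> f) (g' \<star> f')"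
    and hcomp_id: "\<lbrakk>f \<in> hom1 B X Y; g \<in> hom1 B Y Z\<rbrakk> \<Longrightarrow> \<iota> g \<ast> \<iota> f = \<iota> (g \<star> f)"
    and interchange: "\<lbrakk>f \<in> hom1 B X Y; g \<in> hom1 B Y Z; \<alpha> \<in> hom2 B f f'; \<alpha>' \<in> hom2 B f' f'';
        \<beta> \<in> hom2 B g g'; \<beta>' \<in> hom2 B g' g''\<rbrakk>
       \<Longrightarrow> (\<beta>' \<cdot> \<beta>) \<ast> (\<alpha>' \<cdot> \<alpha>) = (\<beta>' \<ast> \<alpha>') \<cdot> (\<beta> \<ast> \<alpha>)"
    and assoc_iso: "\<lbrakk>f \<in> hom1 B W X; g \<in> hom1 B X Y; h \<in> hom1 B Y Z\<rbrakk>
       \<Longrightarrow> \<a> h g f \<in> iso2 B ((h \<star> g) \<star> f) (h \<star> (g \<star> f))"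
    and assoc_natural: "\<lbrakk>f \<in> hom1 B W X; g \<in> hom1 B X Y; h \<in> hom1 B Y Z;
        \<alpha> \<in> hom2 B f f'; \<beta> \<in> hom2 B g g'; \<gamma> \<in> hom2 B h h'\<rbrakk>
       \<Longrightarrow> \<a> h' g' f' \<cdot> ((\<gamma> \<ast> \<beta>) \<ast> \<alpha>) = (\<gamma> \<ast> (\<beta> \<ast> \<alpha>)) \<cdot> \<a> h g f"
    and lunit_iso: "f \<in> hom1 B X Y \<Longrightarrow> \<l> f \<in> iso2 B (\<one> Y \<star> f) f"
    and lunit_natural: "\<lbrakk>f \<in> hom1 B X Y; \<alpha> \<in> hom2 B f f'\<rbrakk>
       \<Longrightarrow> \<l> f' \<cdot> (\<one> Y \<rhd> \<alpha>) = \<alpha> \<cdot> \<l> f"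
    and runit_iso: "f \<in> hom1 B X Y \<Longrightarrow> \<r> f \<in> iso2 B (f \<star> \<one> X) f"
    and runit_natural: "\<lbrakk>f \<in> hom1 B X Y; \<alpha> \<in> hom2 B f f'\<rbrakk>
       \<Longrightarrow> \<r> f' \<cdot> (\<alpha> \<lhd> \<one> X) = \<alpha> \<cdot> \<r> f"
    and pentagon: "\<lbrakk>f \<in> hom1 B V W; g \<in> hom1 B W X; h \<in> hom1 B X Y; k \<in> hom1 B Y Z\<rbrakk>
       \<Longrightarrow> (k \<rhd> \<a> h g f) \<cdot> \<a> k (h \<star> g) f \<cdot> (\<a> k h g \<lhd> f) = \<a> k h (g \<star> f) \<cdot> \<a> (k \<star> h) g f"
    and triangle: "\<lbrakk>f \<in> hom1 B X Y; g \<in> hom1 B Y Z\<rbrakk>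
       \<Longrightarrow> (g \<rhd> \<l> f) \<cdot> \<a> g (\<one> Y) f = \<r> g \<lhd> f"

section \<open>Preassignments, assignments, lax functors, pseudofunctors\<close>

text \<open>
  A functor is presented by its separate components: \<open>F0\<close>, \<open>F1\<close>, \<open>F2\<close> are the actions on
  objects, arrows and 2-cells, \<open>\<xi>\<close> is the unit and \<open>\<phi>\<close> the multiplication. Thus a structure on
  a given preassignment is a choice of further components. Unsubscripted operations are those
  of the target \<open>D\<close>. The associators and unitors that are usually suppressed in the coherence
  axioms, here and for transformations below, are inserted explicitly.
\<close>

locale preassignment = source: bicategory B + target: bicategory D
  for B :: "('o, 'a, 'c) bicat" and D :: "('p, 'b, 'd) bicat" (structure) +
  fixes F0 :: "'o \<Rightarrow> 'p" and F1 :: "'a \<Rightarrow> 'b"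
  assumes F0_Obj: "X \<in> Obj B \<Longrightarrow> F0 X \<in> Obj D"
    and F1_hom: "f \<in> hom1 B X Y \<Longrightarrow> F1 f \<in> hom1 D (F0 X) (F0 Y)"

locale assignment = preassignment B D F0 F1
  for B :: "('o, 'a, 'c) bicat" and D :: "('p, 'b, 'd) bicat" (structure)
    and F0 F1 +
  fixes F2 :: "'c \<Rightarrow> 'd"
  assumes F2_hom: "\<alpha> \<in> hom2 B f g \<Longrightarrow> F2 \<alpha> \<in> hom2 D (F1 f) (F1 g)"
    and F2_id: "f \<in> Arr B \<Longrightarrow> F2 (\<iota>\<^bsub>B\<^esub> f) = \<iota> (F1 f)"
    and F2_vcomp: "\<lbrakk>\<alpha> \<in> hom2 B f g; \<beta> \<in> hom2 B g h\<rbrakk> \<Longrightarrow> F2 (\<beta> \<cdot>\<^bsub>B\<^esub> \<alpha>) = F2 \<beta> \<cdot> F2 \<alpha>"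

locale lax_functor = assignment B D F0 F1 F2
  for B :: "('o, 'a, 'c) bicat" and D :: "('p, 'b, 'd) bicat" (structure)
    and F0 F1 F2 +
  fixes \<xi> :: "'o \<Rightarrow> 'd" and \<phi> :: "'a \<Rightarrow> 'a \<Rightarrow> 'd"
  assumes unit_hom: "X \<in> Obj B \<Longrightarrow> \<xi> X \<in> hom2 D (\<one> (F0 X)) (F1 (\<one>\<^bsub>B\<^esub> X))"
    and mult_hom: "\<lbrakk>f \<in> hom1 B X Y; g \<in> hom1 B Y Z\<rbrakk>
       \<Longrightarrow> \<phi> f g \<in> hom2 D (F1 g \<star> F1 f) (F1 (g \<star>\<^bsub>B\<^esub> f))"
    and mult_natural: "\<lbrakk>f \<in> hom1 B X Y; g \<in> hom1 B Y Z; \<alpha> \<in> hom2 B f f'; \<beta> \<in> hom2 B g g'\<rbrakk>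
       \<Longrightarrow> \<phi> f' g' \<cdot> (F2 \<beta> \<ast> F2 \<alpha>) = F2 (\<beta> \<ast>\<^bsub>B\<^esub> \<alpha>) \<cdot> \<phi> f g"
    and unit_right: "f \<in> hom1 B X Y
       \<Longrightarrow> F2 (\<r>\<^bsub>B\<^esub> f) \<cdot> \<phi> (\<one>\<^bsub>B\<^esub> X) f \<cdot> (F1 f \<rhd> \<xi> X) = \<r> (F1 f)"
    and unit_left: "f \<in> hom1 B X Y
       \<Longrightarrow> F2 (\<l>\<^bsub>B\<^esub> f) \<cdot> \<phi> f (\<one>\<^bsub>B\<^esub> Y) \<cdot> (\<xi> Y \<lhd> F1 f) = \<l> (F1 f)"
    and mult_assoc: "\<lbrakk>f \<in> hom1 B W X; g \<in> hom1 B X Y; h \<in> hom1 B Y Z\<rbrakk>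
       \<Longrightarrow> F2 (\<a>\<^bsub>B\<^esub> h g f) \<cdot> \<phi> f (h \<star>\<^bsub>B\<^esub> g) \<cdot> (\<phi> g h \<lhd> F1 f)
         = \<phi> (g \<star>\<^bsub>B\<^esub> f) h \<cdot> (F1 h \<rhd> \<phi> f g) \<cdot> \<a> (F1 h) (F1 g) (F1 f)"

locale pseudofunctor = lax_functor B D F0 F1 F2 \<xi> \<phi>
  for B :: "('o, 'a, 'c) bicat" and D :: "('p, 'b, 'd) bicat" (structure)
    and F0 F1 F2 \<xi> \<phi> +
  assumes unit_iso: "X \<in> Obj B \<Longrightarrow> \<xi> X \<in> iso2 D (\<one> (F0 X)) (F1 (\<one>\<^bsub>B\<^esub> X))"
    and mult_iso: "\<lbrakk>f \<in> hom1 B X Y; g \<in> hom1 B Y Z\<rbrakk>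
       \<Longrightarrow> \<phi> f g \<in> iso2 D (F1 g \<star> F1 f) (F1 (g \<star>\<^bsub>B\<^esub> f))"

section \<open>Pseudo transformations\<close>

text \<open>
  \<open>T0 X\<close> and \<open>T1 f\<close> are the components \<open>\<theta>\<^sub>X\<close> and \<open>\<theta>\<^sub>f\<close>. The three levels of lax transformation
  correspond to the structure carried by the source \<open>F\<close> and the target \<open>G\<close>; lax functors and
  pseudofunctors share the third level.
\<close>

locale preAssg_lax_transformation =
  F: preassignment B D F0 F1 + G: preassignment B D G0 G1
  for B :: "('o, 'a, 'c) bicat" and D :: "('p, 'b, 'd) bicat" (structure)
    and F0 F1 G0 G1 +
  fixes T0 :: "'o \<Rightarrow> 'b" and T1 :: "'a \<Rightarrow> 'd"
  assumes T0_hom: "X \<in> Obj B \<Longrightarrow> T0 X \<in> hom1 D (F0 X) (G0 X)"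
    and T1_hom: "f \<in> hom1 B X Y \<Longrightarrow> T1 f \<in> hom2 D (G1 f \<star> T0 X) (T0 Y \<star> F1 f)"

locale Assg_lax_transformation =
  preAssg_lax_transformation B D F0 F1 G0 G1 T0 T1 +
  F: assignment B D F0 F1 F2 + G: assignment B D G0 G1 G2
  for B :: "('o, 'a, 'c) bicat" and D :: "('p, 'b, 'd) bicat" (structure)
    and F0 F1 F2 G0 G1 G2 T0 T1 +
  assumes LN0: "\<lbrakk>f \<in> hom1 B X Y; \<alpha> \<in> hom2 B f g\<rbrakk>
       \<Longrightarrow> T1 g \<cdot> (G2 \<alpha> \<lhd> T0 X) = (T0 Y \<rhd> F2 \<alpha>) \<cdot> T1 f"

locale laxFunc_lax_transformation =
  Assg_lax_transformation B D F0 F1 F2 G0 G1 G2 T0 T1 +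
  F: lax_functor B D F0 F1 F2 \<xi>F \<phi>F + G: lax_functor B D G0 G1 G2 \<xi>G \<phi>G
  for B :: "('o, 'a, 'c) bicat" and D :: "('p, 'b, 'd) bicat" (structure)
    and F0 F1 F2 \<xi>F \<phi>F G0 G1 G2 \<xi>G \<phi>G T0 T1 +
  assumes LN1: "X \<in> Obj B
       \<Longrightarrow> (T0 X \<rhd> \<xi>F X) \<cdot> inv2 (\<r> (T0 X)) = T1 (\<one>\<^bsub>B\<^esub> X) \<cdot> (\<xi>G X \<lhd> T0 X) \<cdot> inv2 (\<l> (T0 X))"
    and LN2: "\<lbrakk>f \<in> hom1 B X Y; g \<in> hom1 B Y Z\<rbrakk>
       \<Longrightarrow> (T0 Z \<rhd> \<phi>F f g) \<cdot> \<a> (T0 Z) (F1 g) (F1 f) \<cdot> (T1 g \<lhd> F1 f)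
           \<cdot> inv2 (\<a> (G1 g) (T0 Y) (F1 f)) \<cdot> (G1 g \<rhd> T1 f) \<cdot> \<a> (G1 g) (G1 f) (T0 X)
         = T1 (g \<star>\<^bsub>B\<^esub> f) \<cdot> (\<phi>G f g \<lhd> T0 X)"

definition invertible_components ::
    "('o, 'a, 'c) bicat \<Rightarrow> ('p, 'b, 'd) bicat \<Rightarrow> ('a \<Rightarrow> 'b) \<Rightarrow> ('a \<Rightarrow> 'b)
      \<Rightarrow> ('o \<Rightarrow> 'b) \<Rightarrow> ('a \<Rightarrow> 'd) \<Rightarrow> bool" where
  "invertible_components B D F1 G1 T0 T1 \<longleftrightarrow>
     (\<forall>X Y. \<forall>f \<in> hom1 B X Y. T1 f \<in> iso2 D (G1 f \<star>\<^bsub>D\<^esub> T0 X) (T0 Y \<star>\<^bsub>D\<^esub> F1 f))"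

definition preAssg_pseudo_transformation where
  "preAssg_pseudo_transformation B D F0 F1 G0 G1 T0 T1 \<longleftrightarrow>
     preAssg_lax_transformation B D F0 F1 G0 G1 T0 T1 \<and>
     invertible_components B D F1 G1 T0 T1"

definition Assg_pseudo_transformation where
  "Assg_pseudo_transformation B D F0 F1 F2 G0 G1 G2 T0 T1 \<longleftrightarrow>
     Assg_lax_transformation B D F0 F1 F2 G0 G1 G2 T0 T1 \<and>
     invertible_components B D F1 G1 T0 T1"

definition laxFunc_pseudo_transformation where
  "laxFunc_pseudo_transformation B D F0 F1 F2 \<xi>F \<phi>F G0 G1 G2 \<xi>G \<phi>G T0 T1 \<longleftrightarrow>
     laxFunc_lax_transformation B D F0 F1 F2 \<xi>F \<phi>F G0 G1 G2 \<xi>G \<phi>G T0 T1 \<and>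
     invertible_components B D F1 G1 T0 T1"

section \<open>Transfer data\<close>

text \<open>For \<open>t : X \<rightarrow> Y\<close>, these concern the functor \<open>t\<^sub>* : D(W, X) \<rightarrow> D(W, Y)\<close> that sends
  \<open>\<sigma> : u \<Rightarrow> v\<close> to \<open>t \<rhd> \<sigma> : t \<star> u \<Rightarrow> t \<star> v\<close>.\<close>

definition postcomp_full :: "('p, 'b, 'd) bicat \<Rightarrow> 'b \<Rightarrow> 'p \<Rightarrow> bool" where
  "postcomp_full D t W \<longleftrightarrow>
     (\<forall>u \<in> hom1 D W (src1 D t). \<forall>v \<in> hom1 D W (src1 D t).
        \<forall>\<tau> \<in> hom2 D (t \<star>\<^bsub>D\<^esub> u) (t \<star>\<^bsub>D\<^esub> v). \<exists>\<sigma> \<in> hom2 D u v. t \<rhd>\<^bsub>D\<^esub> \<sigma> = \<tau>)"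

definition postcomp_faithful :: "('p, 'b, 'd) bicat \<Rightarrow> 'b \<Rightarrow> 'p \<Rightarrow> bool" where
  "postcomp_faithful D t W \<longleftrightarrow>
     (\<forall>u \<in> hom1 D W (src1 D t). \<forall>v \<in> hom1 D W (src1 D t).
        inj_on (\<lambda>\<sigma>. t \<rhd>\<^bsub>D\<^esub> \<sigma>) (hom2 D u v))"

definition transfer_condition ::
    "('o, 'a, 'c) bicat \<Rightarrow> ('p, 'b, 'd) bicat \<Rightarrow> ('o \<Rightarrow> 'p) \<Rightarrow> ('o \<Rightarrow> 'b) \<Rightarrow> bool" where
  "transfer_condition B D F0 T0 \<longleftrightarrow>
     (\<forall>W \<in> F0 ` Obj B. \<forall>X \<in> Obj B. postcomp_full D (T0 X) W \<and> postcomp_faithful D (T0 X) W)"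

definition preAssg_transfer_datum where
  "preAssg_transfer_datum B D F0 F1 G0 G1 T0 T1 \<longleftrightarrow>
     preAssg_pseudo_transformation B D F0 F1 G0 G1 T0 T1 \<and> transfer_condition B D F0 T0"

definition Assg_transfer_datum where
  "Assg_transfer_datum B D F0 F1 F2 G0 G1 G2 T0 T1 \<longleftrightarrow>
     Assg_pseudo_transformation B D F0 F1 F2 G0 G1 G2 T0 T1 \<and> transfer_condition B D F0 T0"

definition laxFunc_transfer_datum where
  "laxFunc_transfer_datum B D F0 F1 F2 \<xi>F \<phi>F G0 G1 G2 \<xi>G \<phi>G T0 T1 \<longleftrightarrow>
     laxFunc_pseudo_transformation B D F0 F1 F2 \<xi>F \<phi>F G0 G1 G2 \<xi>G \<phi>G T0 T1 \<and>
     transfer_condition B D F0 T0"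

definition psdFunc_transfer_datum where
  "psdFunc_transfer_datum B D F0 F1 F2 \<xi>F \<phi>F G0 G1 G2 \<xi>G \<phi>G T0 T1 \<longleftrightarrow>
     pseudofunctor B D F0 F1 F2 \<xi>F \<phi>F \<and> pseudofunctor B D G0 G1 G2 \<xi>G \<phi>G \<and>
     laxFunc_transfer_datum B D F0 F1 F2 \<xi>F \<phi>F G0 G1 G2 \<xi>G \<phi>G T0 T1"

section \<open>Equality of structures\<close>

text \<open>Structure maps are total functions whose values off the carriers carry no information,
  so two structures are the same when they agree on the carriers.\<close>

definition same_cell_map :: "('o, 'a, 'c) bicat \<Rightarrow> ('c \<Rightarrow> 'd) \<Rightarrow> ('c \<Rightarrow> 'd) \<Rightarrow> bool" where
  "same_cell_map B F2 F2' \<longleftrightarrow> (\<forall>\<alpha> \<in> Cell B. F2 \<alpha> = F2' \<alpha>)"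

definition same_unit :: "('o, 'a, 'c) bicat \<Rightarrow> ('o \<Rightarrow> 'd) \<Rightarrow> ('o \<Rightarrow> 'd) \<Rightarrow> bool" where
  "same_unit B \<xi> \<xi>' \<longleftrightarrow> (\<forall>X \<in> Obj B. \<xi> X = \<xi>' X)"

definition same_mult ::
    "('o, 'a, 'c) bicat \<Rightarrow> ('a \<Rightarrow> 'a \<Rightarrow> 'd) \<Rightarrow> ('a \<Rightarrow> 'a \<Rightarrow> 'd) \<Rightarrow> bool" where
  "same_mult B \<phi> \<phi>' \<longleftrightarrow> (\<forall>X Y Z. \<forall>f \<in> hom1 B X Y. \<forall>g \<in> hom1 B Y Z. \<phi> f g = \<phi>' f g)"

end

theory Submission
  imports Defs
begin

text \<open>
  Given a family of arrows \<open>\<theta>\<^sub>X : FX \<rightarrow> GX\<close>, call \<open>(p, u, t)\<close> with \<open>t : p \<star> \<theta>\<^sub>X \<Rightarrow> \<theta>\<^sub>Y \<star> u\<close> a square, and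
  call a pair \<open>\<pi> : p \<Rightarrow> p'\<close>, \<open>\<sigma> : u \<Rightarrow> u'\<close> with \<open>t' \<cdot> (\<pi> \<lhd> \<theta>\<^sub>X) = (\<theta>\<^sub>Y \<rhd> \<sigma>) \<cdot> t\<close> a cell of squares, with
  \<open>\<sigma>\<close> lying over \<open>\<pi>\<close>. Squares compose by pasting, and cells of squares are closed under both
  compositions and include the pairs of associators and of unitors. The axioms LN0, LN1 and LN2 say
  precisely that \<open>F\<alpha>\<close>, \<open>\<xi>\<^sup>F\<close> and \<open>\<phi>\<^sup>F\<close> lie over \<open>G\<alpha>\<close>, \<open>\<xi>\<^sup>G\<close> and \<open>\<phi>\<^sup>G\<close>. If \<open>t\<close> is invertible and
  postcomposition with \<open>\<theta>\<^sub>Y\<close> is full and faithful, exactly one \<open>\<sigma>\<close> lies over a given \<open>\<pi>\<close>, and it is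
  invertible when \<open>\<pi>\<close> is (for \<open>t'\<close> invertible). So the structure on \<open>F\<close> exists and is unique, and each
  of its axioms holds because both sides lie over the two equal sides of the same axiom for \<open>G\<close>.
\<close>

section \<open>Calculus in a bicategory\<close>

context bicategory
begin

section \<open>Sources, targets and the laws of composition as rewrite rules\<close>

lemma hom1_iff: "f \<in> hom1 B X Y \<longleftrightarrow> f \<in> Arr B \<and> src1 B f = X \<and> trg1 B f = Y"
  by (simp add: hom1_def)

lemma hom2_iff: "\<alpha> \<in> hom2 B f g \<longleftrightarrow> \<alpha> \<in> Cell B \<and> src2 B \<alpha> = f \<and> trg2 B \<alpha> = g"
  by (simp add: hom2_def)

lemma hom2_hom1: "\<lbrakk>\<alpha> \<in> hom2 B f g; f \<in> hom1 B X Y\<rbrakk> \<Longrightarrow> g \<in> hom1 B X Y"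
  using trg2_Arr globular_src globular_trg by (auto simp: hom1_iff hom2_iff)

lemma globular_simps [simp]:
  "\<alpha> \<in> Cell B \<Longrightarrow> src1 B (trg2 B \<alpha>) = src1 B (src2 B \<alpha>)"
  "\<alpha> \<in> Cell B \<Longrightarrow> trg1 B (trg2 B \<alpha>) = trg1 B (src2 B \<alpha>)"
  by (simp_all add: globular_src globular_trg)

lemmas carrier_simps [simp] = src1_Obj trg1_Obj src2_Arr trg2_Arr

lemma id1_simps [simp]:
  assumes "X \<in> Obj B"
  shows "\<one> X \<in> Arr B" "src1 B (\<one> X) = X" "trg1 B (\<one> X) = X"
  using id1_hom [OF assms] by (auto simp: hom1_iff)

lemma comp1_simps [simp]:
  assumes "f \<in> Arr B" "g \<in> Arr B" "src1 B g = trg1 B f"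
  shows "g \<star> f \<in> Arr B" "src1 B (g \<star> f) = src1 B f" "trg1 B (g \<star> f) = trg1 B g"
  using comp1_hom [of f "src1 B f" "trg1 B f" g "trg1 B g"] assms by (auto simp: hom1_iff)

lemma id2_simps [simp]:
  assumes "f \<in> Arr B"
  shows "\<iota> f \<in> Cell B" "src2 B (\<iota> f) = f" "trg2 B (\<iota> f) = f"
  using id2_hom [OF assms] by (auto simp: hom2_iff)

lemma vcomp_simps [simp]:
  assumes "\<alpha> \<in> Cell B" "\<beta> \<in> Cell B" "src2 B \<beta> = trg2 B \<alpha>"
  shows "\<beta> \<cdot> \<alpha> \<in> Cell B" "src2 B (\<beta> \<cdot> \<alpha>) = src2 B \<alpha>" "trg2 B (\<beta> \<cdot> \<alpha>) = trg2 B \<beta>"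
  using vcomp_hom [of \<alpha> "src2 B \<alpha>" "trg2 B \<alpha>" \<beta> "trg2 B \<beta>"] assms by (auto simp: hom2_iff)

lemma vcomp_id_simps [simp]:
  "\<lbrakk>\<alpha> \<in> Cell B; trg2 B \<alpha> = g\<rbrakk> \<Longrightarrow> \<iota> g \<cdot> \<alpha> = \<alpha>"
  "\<lbrakk>\<alpha> \<in> Cell B; src2 B \<alpha> = f\<rbrakk> \<Longrightarrow> \<alpha> \<cdot> \<iota> f = \<alpha>"
  using vcomp_id_left vcomp_id_right by (auto simp: hom2_iff)

text \<open>Vertical composites are normalised to bracket to the right. Arguments that need another
  bracketing remove this rule or apply it backwards.\<close>

lemma vcomp_assoc_simp [simp]:
  "\<lbrakk>\<alpha> \<in> Cell B; \<beta> \<in> Cell B; \<gamma> \<in> Cell B; src2 B \<beta> = trg2 B \<alpha>; src2 B \<gamma> = trg2 B \<beta>\<rbrakk>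
    \<Longrightarrow> (\<gamma> \<cdot> \<beta>) \<cdot> \<alpha> = \<gamma> \<cdot> \<beta> \<cdot> \<alpha>"
  using vcomp_assoc [of \<alpha> _ _ \<beta> _ \<gamma>] by (auto simp: hom2_iff)

lemma hcomp_simps [simp]:
  assumes "\<alpha> \<in> Cell B" "\<beta> \<in> Cell B" "src1 B (src2 B \<beta>) = trg1 B (src2 B \<alpha>)"
  shows "\<beta> \<ast> \<alpha> \<in> Cell B" "src2 B (\<beta> \<ast> \<alpha>) = src2 B \<beta> \<star> src2 B \<alpha>"
    "trg2 B (\<beta> \<ast> \<alpha>) = trg2 B \<beta> \<star> trg2 B \<alpha>"
  using hcomp_hom [of "src2 B \<alpha>" _ _ "src2 B \<beta>" _ \<alpha> "trg2 B \<alpha>" \<beta> "trg2 B \<beta>"] assms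
  by (auto simp: hom1_iff hom2_iff)

lemma hcomp_id_simp [simp]:
  "\<lbrakk>f \<in> Arr B; g \<in> Arr B; src1 B g = trg1 B f\<rbrakk> \<Longrightarrow> \<iota> g \<ast> \<iota> f = \<iota> (g \<star> f)"
  using hcomp_id by (auto simp: hom1_iff)

text \<open>Oriented so that adjacent horizontal composites merge into one; identities in the
  factors then vanish, and equations between whiskerings reduce to vertical ones.\<close>

lemma interchange':
  "\<lbrakk>\<alpha> \<in> Cell B; \<alpha>' \<in> Cell B; \<beta> \<in> Cell B; \<beta>' \<in> Cell B; src2 B \<alpha>' = trg2 B \<alpha>; src2 B \<beta>' = trg2 B \<beta>;
    src1 B (src2 B \<beta>) = trg1 B (src2 B \<alpha>)\<rbrakk>
    \<Longrightarrow> (\<beta>' \<ast> \<alpha>') \<cdot> (\<beta> \<ast> \<alpha>) = (\<beta>' \<cdot> \<beta>) \<ast> (\<alpha>' \<cdot> \<alpha>)"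
  using interchange [of "src2 B \<alpha>" _ _ "src2 B \<beta>" _ \<alpha> _ \<alpha>' _ \<beta> _ \<beta>']
  by (auto simp: hom1_iff hom2_iff)

lemma lwhisker_vcomp:
  "\<lbrakk>\<alpha> \<in> Cell B; \<beta> \<in> Cell B; src2 B \<beta> = trg2 B \<alpha>; f \<in> Arr B; src1 B f = trg1 B (src2 B \<alpha>)\<rbrakk>
    \<Longrightarrow> f \<rhd> (\<beta> \<cdot> \<alpha>) = (f \<rhd> \<beta>) \<cdot> (f \<rhd> \<alpha>)"
  by (simp add: interchange')

lemma rwhisker_vcomp:
  "\<lbrakk>\<alpha> \<in> Cell B; \<beta> \<in> Cell B; src2 B \<beta> = trg2 B \<alpha>; f \<in> Arr B; trg1 B f = src1 B (src2 B \<alpha>)\<rbrakk>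
    \<Longrightarrow> (\<beta> \<cdot> \<alpha>) \<lhd> f = (\<beta> \<lhd> f) \<cdot> (\<alpha> \<lhd> f)"
  by (simp add: interchange')

subsection \<open>Invertible 2-cells\<close>

lemma inverse_cells_unique:
  assumes "inverse_cells B \<alpha> \<beta>" "inverse_cells B \<alpha> \<gamma>"
  shows "\<beta> = \<gamma>"
proof -
  have "\<beta> = (\<gamma> \<cdot> \<alpha>) \<cdot> \<beta>"
    using assms by (auto simp: inverse_cells_def hom2_iff simp del: vcomp_assoc_simp)
  also have "\<dots> = \<gamma> \<cdot> \<alpha> \<cdot> \<beta>"
    using assms by (intro vcomp_assoc_simp) (auto simp: inverse_cells_def hom2_iff)
  also have "\<dots> = \<gamma>"
    using assms by (auto simp: inverse_cells_def hom2_iff)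
  finally show ?thesis .
qed

definition iso_cell :: "'c \<Rightarrow> bool" where
  "iso_cell \<alpha> \<longleftrightarrow> (\<exists>\<beta>. inverse_cells B \<alpha> \<beta>)"

lemma iso2_iff: "\<alpha> \<in> iso2 B f g \<longleftrightarrow> iso_cell \<alpha> \<and> \<alpha> \<in> Cell B \<and> src2 B \<alpha> = f \<and> trg2 B \<alpha> = g"
  by (auto simp: iso2_def iso_cell_def hom2_iff)

lemma inverse_cells_inv2: "iso_cell \<alpha> \<Longrightarrow> inverse_cells B \<alpha> (inv2 \<alpha>)"
  unfolding iso_cell_def inv2_def using inverse_cells_unique by (auto intro: theI)

lemma iso_cell_Cell: "iso_cell \<alpha> \<Longrightarrow> \<alpha> \<in> Cell B"
  by (auto simp: iso_cell_def inverse_cells_def)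

lemma inv2_simps [simp]:
  assumes "iso_cell \<alpha>"
  shows "inv2 \<alpha> \<in> Cell B" "src2 B (inv2 \<alpha>) = trg2 B \<alpha>" "trg2 B (inv2 \<alpha>) = src2 B \<alpha>"
    "inv2 \<alpha> \<cdot> \<alpha> = \<iota> (src2 B \<alpha>)" "\<alpha> \<cdot> inv2 \<alpha> = \<iota> (trg2 B \<alpha>)"
  using inverse_cells_inv2 [OF assms] by (auto simp: inverse_cells_def hom2_iff)

text \<open>In a composite bracketed to the right, a cell and its inverse are separated by the
  bracket around the tail \<open>\<beta>\<close>, so cancellation needs a form with a tail.\<close>

lemma inv2_cancel [simp]:
  assumes "iso_cell \<alpha>" "\<beta> \<in> Cell B"
  shows "trg2 B \<beta> = src2 B \<alpha> \<Longrightarrow> inv2 \<alpha> \<cdot> \<alpha> \<cdot> \<beta> = \<beta>"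
    and "trg2 B \<beta> = trg2 B \<alpha> \<Longrightarrow> \<alpha> \<cdot> inv2 \<alpha> \<cdot> \<beta> = \<beta>"
proof -
  note \<alpha> = iso_cell_Cell [OF assms(1)]
  show "inv2 \<alpha> \<cdot> \<alpha> \<cdot> \<beta> = \<beta>" if "trg2 B \<beta> = src2 B \<alpha>"
    using that assms \<alpha> by (simp flip: vcomp_assoc_simp)
  show "\<alpha> \<cdot> inv2 \<alpha> \<cdot> \<beta> = \<beta>" if "trg2 B \<beta> = trg2 B \<alpha>"
    using that assms \<alpha> by (simp flip: vcomp_assoc_simp)
qed

lemma cancel_left:
  assumes "iso_cell \<gamma>" "\<alpha> \<in> Cell B" "\<beta> \<in> Cell B" "trg2 B \<alpha> = src2 B \<gamma>" "trg2 B \<beta> = src2 B \<gamma>"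
    "\<gamma> \<cdot> \<alpha> = \<gamma> \<cdot> \<beta>"
  shows "\<alpha> = \<beta>"
  using assms inv2_cancel(1) by metis

lemma cancel_right:
  assumes "iso_cell \<gamma>" "\<alpha> \<in> Cell B" "\<beta> \<in> Cell B" "src2 B \<alpha> = trg2 B \<gamma>" "src2 B \<beta> = trg2 B \<gamma>"
    "\<alpha> \<cdot> \<gamma> = \<beta> \<cdot> \<gamma>"
  shows "\<alpha> = \<beta>"
proof -
  have "\<alpha> = (\<alpha> \<cdot> \<gamma>) \<cdot> inv2 \<gamma>" "\<beta> = (\<beta> \<cdot> \<gamma>) \<cdot> inv2 \<gamma>"
    using assms(1-5) iso_cell_Cell by auto
  then show ?thesis using assms(6) by simp
qed

lemma iso_cellI:
  assumes "\<alpha> \<in> Cell B" "\<beta> \<in> Cell B" "src2 B \<beta> = trg2 B \<alpha>" "trg2 B \<beta> = src2 B \<alpha>"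
    "\<beta> \<cdot> \<alpha> = \<iota> (src2 B \<alpha>)" "\<alpha> \<cdot> \<beta> = \<iota> (trg2 B \<alpha>)"
  shows "iso_cell \<alpha>"
  using assms by (auto simp: iso_cell_def inverse_cells_def hom2_iff)

lemma iso_cell_vcomp [simp]:
  assumes "iso_cell \<alpha>" "iso_cell \<beta>" "src2 B \<beta> = trg2 B \<alpha>"
  shows "iso_cell (\<beta> \<cdot> \<alpha>)"
  using assms iso_cell_Cell by (intro iso_cellI [where \<beta> = "inv2 \<alpha> \<cdot> inv2 \<beta>"]) auto

lemma iso_cell_rwhisker [simp]:
  assumes "iso_cell \<alpha>" "f \<in> Arr B" "trg1 B f = src1 B (src2 B \<alpha>)"
  shows "iso_cell (\<alpha> \<lhd> f)"
  using assms iso_cell_Cell by (intro iso_cellI [where \<beta> = "inv2 \<alpha> \<lhd> f"]) (auto simp: interchange')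

lemma iso_cell_lwhisker [simp]:
  assumes "iso_cell \<alpha>" "f \<in> Arr B" "src1 B f = trg1 B (src2 B \<alpha>)"
  shows "iso_cell (f \<rhd> \<alpha>)"
  using assms iso_cell_Cell by (intro iso_cellI [where \<beta> = "f \<rhd> inv2 \<alpha>"]) (auto simp: interchange')

lemma iso_cell_inv2 [simp]: "iso_cell \<alpha> \<Longrightarrow> iso_cell (inv2 \<alpha>)"
  by (rule iso_cellI [where \<beta> = \<alpha>]) (simp_all add: iso_cell_Cell)

lemma inv2_eqI: "inverse_cells B \<alpha> \<beta> \<Longrightarrow> inv2 \<alpha> = \<beta>"
  unfolding inv2_def using inverse_cells_unique by blast

lemma inv2_lwhisker:
  assumes "iso_cell \<alpha>" "f \<in> Arr B" "src1 B f = trg1 B (src2 B \<alpha>)"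
  shows "inv2 (f \<rhd> \<alpha>) = f \<rhd> inv2 \<alpha>"
  using assms iso_cell_Cell by (intro inv2_eqI) (auto simp: inverse_cells_def hom2_iff interchange')

lemma inv2_rwhisker:
  assumes "iso_cell \<alpha>" "f \<in> Arr B" "trg1 B f = src1 B (src2 B \<alpha>)"
  shows "inv2 (\<alpha> \<lhd> f) = inv2 \<alpha> \<lhd> f"
  using assms iso_cell_Cell by (intro inv2_eqI) (auto simp: inverse_cells_def hom2_iff interchange')

text \<open>Composing with the two inverses reverses the opposite sides \<open>\<gamma>\<close> and
  \<open>\<delta>\<close>. This yields naturality of inverse associators and the forms of the
  pentagon that contain inverses.\<close>

lemma inverse_square:
  assumes "\<beta> \<cdot> \<gamma> = \<delta> \<cdot> \<alpha>" "iso_cell \<gamma>" "iso_cell \<delta>" "\<alpha> \<in> Cell B" "\<beta> \<in> Cell B"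
    "src2 B \<alpha> = src2 B \<gamma>" "trg2 B \<alpha> = src2 B \<delta>" "src2 B \<beta> = trg2 B \<gamma>"
    "trg2 B \<beta> = trg2 B \<delta>"
  shows "inv2 \<delta> \<cdot> \<beta> = \<alpha> \<cdot> inv2 \<gamma>"
proof -
  have "inv2 \<delta> \<cdot> \<beta> = inv2 \<delta> \<cdot> (\<beta> \<cdot> \<gamma>) \<cdot> inv2 \<gamma>"
    using assms(2-) iso_cell_Cell by auto
  also have "\<dots> = inv2 \<delta> \<cdot> (\<delta> \<cdot> \<alpha>) \<cdot> inv2 \<gamma>" by (simp add: assms(1))
  also have "\<dots> = \<alpha> \<cdot> inv2 \<gamma>"
    using assms(2-) iso_cell_Cell by auto
  finally show ?thesis .
qed

text \<open>Two commuting squares are glued along the common side \<open>b\<close>. The equations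
  stand first, so that long pastings can be chained with \<open>OF\<close>, leaving all typing
  conditions to the end.\<close>

lemma paste_squares:
  assumes "y' \<cdot> b = c \<cdot> x'" "y \<cdot> a = b \<cdot> x"
    and "a \<in> Cell B" "b \<in> Cell B" "c \<in> Cell B" "x \<in> Cell B" "y \<in> Cell B" "x' \<in> Cell B" "y' \<in> Cell B"
    and "src2 B y = trg2 B a" "src2 B b = trg2 B x" "src2 B y' = trg2 B b" "src2 B c = trg2 B x'"
      "trg2 B y = trg2 B b" "src2 B b = src2 B x'"
  shows "(y' \<cdot> y) \<cdot> a = c \<cdot> (x' \<cdot> x)"
proof -
  have "(y' \<cdot> y) \<cdot> a = y' \<cdot> (y \<cdot> a)" using assms(3-) by simp
  also have "\<dots> = y' \<cdot> (b \<cdot> x)" by (simp only: assms(2))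
  also have "\<dots> = (y' \<cdot> b) \<cdot> x" using assms(3-) by simp
  also have "\<dots> = (c \<cdot> x') \<cdot> x" by (simp only: assms(1))
  also have "\<dots> = c \<cdot> (x' \<cdot> x)" using assms(3-) by simp
  finally show ?thesis .
qed

subsection \<open>Coherence\<close>

lemma assoc_simps [simp]:
  assumes "f \<in> Arr B" "g \<in> Arr B" "h \<in> Arr B" "src1 B g = trg1 B f" "src1 B h = trg1 B g"
  shows "iso_cell (\<a> h g f)" "\<a> h g f \<in> Cell B"
    "src2 B (\<a> h g f) = (h \<star> g) \<star> f" "trg2 B (\<a> h g f) = h \<star> g \<star> f"
  using assoc_iso [of f _ _ g _ h] assms by (auto simp: hom1_iff iso2_iff)

lemma lunit_simps [simp]:
  assumes "f \<in> Arr B"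
  shows "iso_cell (\<l> f)" "\<l> f \<in> Cell B" "src2 B (\<l> f) = \<one> (trg1 B f) \<star> f" "trg2 B (\<l> f) = f"
  using lunit_iso [of f] assms by (auto simp: hom1_iff iso2_iff)

lemma runit_simps [simp]:
  assumes "f \<in> Arr B"
  shows "iso_cell (\<r> f)" "\<r> f \<in> Cell B" "src2 B (\<r> f) = f \<star> \<one> (src1 B f)" "trg2 B (\<r> f) = f"
  using runit_iso [of f] assms by (auto simp: hom1_iff iso2_iff)

lemma assoc_natural':
  assumes "\<alpha> \<in> hom2 B f f'" "\<beta> \<in> hom2 B g g'" "\<gamma> \<in> hom2 B h h'"
    "src1 B g = trg1 B f" "src1 B h = trg1 B g"
  shows "\<a> h' g' f' \<cdot> ((\<gamma> \<ast> \<beta>) \<ast> \<alpha>) = (\<gamma> \<ast> (\<beta> \<ast> \<alpha>)) \<cdot> \<a> h g f"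
  using assoc_natural [OF _ _ _ assms(1-3)] assms by (auto simp: hom1_iff hom2_iff)

lemma assoc_inv_natural:
  assumes "\<alpha> \<in> hom2 B f f'" "\<beta> \<in> hom2 B g g'" "\<gamma> \<in> hom2 B h h'"
    "src1 B g = trg1 B f" "src1 B h = trg1 B g"
  shows "inv2 (\<a> h' g' f') \<cdot> (\<gamma> \<ast> (\<beta> \<ast> \<alpha>)) = ((\<gamma> \<ast> \<beta>) \<ast> \<alpha>) \<cdot> inv2 (\<a> h g f)"
  using assoc_natural' [OF assms] assms by (intro inverse_square) (auto simp: hom2_iff)

lemma lunit_natural':
  "\<lbrakk>\<alpha> \<in> hom2 B f f'; Y = trg1 B f\<rbrakk> \<Longrightarrow> \<l> f' \<cdot> (\<one> Y \<rhd> \<alpha>) = \<alpha> \<cdot> \<l> f"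
  using lunit_natural by (auto simp: hom1_iff hom2_iff)

lemma runit_natural':
  "\<lbrakk>\<alpha> \<in> hom2 B f f'; X = src1 B f\<rbrakk> \<Longrightarrow> \<r> f' \<cdot> (\<alpha> \<lhd> \<one> X) = \<alpha> \<cdot> \<r> f"
  using runit_natural by (auto simp: hom1_iff hom2_iff)

lemma pentagon':
  "\<lbrakk>f \<in> Arr B; g \<in> Arr B; h \<in> Arr B; k \<in> Arr B;
    src1 B g = trg1 B f; src1 B h = trg1 B g; src1 B k = trg1 B h\<rbrakk>
    \<Longrightarrow> (k \<rhd> \<a> h g f) \<cdot> \<a> k (h \<star> g) f \<cdot> (\<a> k h g \<lhd> f) = \<a> k h (g \<star> f) \<cdot> \<a> (k \<star> h) g f"
  using pentagon by (auto simp: hom1_iff)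

lemma triangle':
  "\<lbrakk>f \<in> Arr B; g \<in> Arr B; src1 B g = trg1 B f; Y = trg1 B f\<rbrakk>
    \<Longrightarrow> (g \<rhd> \<l> f) \<cdot> \<a> g (\<one> Y) f = \<r> g \<lhd> f"
  using triangle by (auto simp: hom1_iff)

text \<open>Naturality of \<open>\<l>\<close> turns the hypothesis into
  \<open>\<alpha> \<cdot> \<l> f = \<beta> \<cdot> \<l> f\<close>, and the invertible
  \<open>\<l> f\<close> cancels.\<close>

lemma id_whisker_faithful:
  assumes "\<alpha> \<in> hom2 B f g" "\<beta> \<in> hom2 B f g" "\<one> (trg1 B f) \<rhd> \<alpha> = \<one> (trg1 B f) \<rhd> \<beta>"
  shows "\<alpha> = \<beta>"
proof (rule cancel_right)
  show "\<alpha> \<cdot> \<l> f = \<beta> \<cdot> \<l> f"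
    using assms lunit_natural' [OF assms(1)] lunit_natural' [OF assms(2)] by simp
qed (use assms in \<open>auto simp: hom2_iff\<close>)

lemma whisker_id_faithful:
  assumes "\<alpha> \<in> hom2 B f g" "\<beta> \<in> hom2 B f g" "\<alpha> \<lhd> \<one> (src1 B f) = \<beta> \<lhd> \<one> (src1 B f)"
  shows "\<alpha> = \<beta>"
proof (rule cancel_right)
  show "\<alpha> \<cdot> \<r> f = \<beta> \<cdot> \<r> f"
    using assms runit_natural' [OF assms(1)] runit_natural' [OF assms(2)] by simp
qed (use assms in \<open>auto simp: hom2_iff\<close>)

text \<open>
  Kelly's derivation of the two remaining unit coherences: whisker with an identity arrow, which is
  faithful, and compare the two sides through the pentagon with two identities.
\<close>

lemma lunit_comp:
  assumes [simp]: "f \<in> Arr B" "g \<in> Arr B" "src1 B g = trg1 B f"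
  shows "\<l> (g \<star> f) \<cdot> \<a> (\<one> (trg1 B g)) g f = \<l> g \<lhd> f"
proof (rule id_whisker_faithful)
  let ?I = "\<one> (trg1 B g)"
  let ?P = "\<a> ?I (?I \<star> g) f \<cdot> (\<a> ?I ?I g \<lhd> f)"
  have "(?I \<rhd> (\<l> (g \<star> f) \<cdot> \<a> ?I g f)) \<cdot> ?P
      = (?I \<rhd> \<l> (g \<star> f)) \<cdot> (?I \<rhd> \<a> ?I g f) \<cdot> ?P"
    by (simp add: lwhisker_vcomp)
  also have "\<dots> = ((?I \<rhd> \<l> (g \<star> f)) \<cdot> \<a> ?I ?I (g \<star> f)) \<cdot> \<a> (?I \<star> ?I) g f"
    by (simp add: pentagon')
  \<comment> \<open>The triangle is used twice: here at \<open>g \<star> f\<close>, and below at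
    \<open>g\<close> under whiskering with \<open>f\<close>. The cell \<open>\<r> ?I\<close> joins
    the two uses.\<close>
  also have "\<dots> = (\<r> ?I \<lhd> (g \<star> f)) \<cdot> \<a> (?I \<star> ?I) g f"
    by (subst triangle') simp_all
  also have "\<dots> = \<a> ?I g f \<cdot> ((\<r> ?I \<lhd> g) \<lhd> f)"
    using assoc_natural' [of "\<iota> f" f f "\<iota> g" g g "\<r> ?I" "?I \<star> ?I" ?I] by (simp add: hom2_iff)
  also have "\<dots> = \<a> ?I g f \<cdot> (((?I \<rhd> \<l> g) \<cdot> \<a> ?I ?I g) \<lhd> f)"
    by (subst triangle') simp_all
  also have "\<dots> = (\<a> ?I g f \<cdot> ((?I \<rhd> \<l> g) \<lhd> f)) \<cdot> (\<a> ?I ?I g \<lhd> f)"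
    by (simp add: rwhisker_vcomp)
  also have "\<dots> = ((?I \<rhd> (\<l> g \<lhd> f)) \<cdot> \<a> ?I (?I \<star> g) f) \<cdot> (\<a> ?I ?I g \<lhd> f)"
    by (subst assoc_natural' [of "\<iota> f" f f _ "?I \<star> g" _ _ ?I]) (simp_all add: hom2_iff)
  also have "\<dots> = (?I \<rhd> (\<l> g \<lhd> f)) \<cdot> ?P"
    by simp
  finally have *: "(?I \<rhd> (\<l> (g \<star> f) \<cdot> \<a> ?I g f)) \<cdot> ?P = (?I \<rhd> (\<l> g \<lhd> f)) \<cdot> ?P" .
  have "?I \<rhd> (\<l> (g \<star> f) \<cdot> \<a> ?I g f) = ?I \<rhd> (\<l> g \<lhd> f)"
    by (rule cancel_right [OF _ _ _ _ _ *]) auto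
  then show "\<one> (trg1 B ((?I \<star> g) \<star> f)) \<rhd> (\<l> (g \<star> f) \<cdot> \<a> ?I g f)
      = \<one> (trg1 B ((?I \<star> g) \<star> f)) \<rhd> (\<l> g \<lhd> f)"
    by simp
qed (simp_all add: hom2_iff)

lemma runit_comp:
  assumes [simp]: "f \<in> Arr B" "g \<in> Arr B" "src1 B g = trg1 B f"
  shows "(g \<rhd> \<r> f) \<cdot> \<a> g f (\<one> (src1 B f)) = \<r> (g \<star> f)"
proof (rule whisker_id_faithful)
  let ?I = "\<one> (src1 B f)"
  let ?a = "\<a> g f ?I"
  \<comment> \<open>Composing with the invertible \<open>?a\<close> on the left makes naturality of
    the associator applicable; \<open>?a\<close> is cancelled at the end.\<close>
  have "?a \<cdot> (((g \<rhd> \<r> f) \<cdot> ?a) \<lhd> ?I) = (?a \<cdot> ((g \<rhd> \<r> f) \<lhd> ?I)) \<cdot> (?a \<lhd> ?I)"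
    by (simp add: rwhisker_vcomp)
  also have "\<dots> = ((g \<rhd> (\<r> f \<lhd> ?I)) \<cdot> \<a> g (f \<star> ?I) ?I) \<cdot> (?a \<lhd> ?I)"
    by (subst assoc_natural' [of "\<iota> ?I" ?I ?I _ "f \<star> ?I" _ _ g]) (simp_all add: hom2_iff)
  \<comment> \<open>The triangle is read backwards, splitting \<open>\<r> f \<lhd> ?I\<close> so
    that its associator can enter the pentagon.\<close>
  also have "\<dots> = ((g \<rhd> ((f \<rhd> \<l> ?I) \<cdot> \<a> f ?I ?I)) \<cdot> \<a> g (f \<star> ?I) ?I) \<cdot> (?a \<lhd> ?I)"
    by (subst triangle') simp_all
  also have "\<dots> = (g \<rhd> (f \<rhd> \<l> ?I)) \<cdot> (g \<rhd> \<a> f ?I ?I) \<cdot> \<a> g (f \<star> ?I) ?I \<cdot> (?a \<lhd> ?I)"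
    by (simp add: lwhisker_vcomp)
  also have "\<dots> = ((g \<rhd> (f \<rhd> \<l> ?I)) \<cdot> \<a> g f (?I \<star> ?I)) \<cdot> \<a> (g \<star> f) ?I ?I"
    by (simp add: pentagon')
  also have "\<dots> = (?a \<cdot> ((g \<star> f) \<rhd> \<l> ?I)) \<cdot> \<a> (g \<star> f) ?I ?I"
    using assoc_natural' [of "\<l> ?I" "?I \<star> ?I" ?I "\<iota> f" f f "\<iota> g" g g] by (simp add: hom2_iff)
  also have "\<dots> = ?a \<cdot> ((g \<star> f) \<rhd> \<l> ?I) \<cdot> \<a> (g \<star> f) ?I ?I"
    by simp
  also have "\<dots> = ?a \<cdot> (\<r> (g \<star> f) \<lhd> ?I)"
    by (subst triangle') simp_all
  finally have *: "?a \<cdot> (((g \<rhd> \<r> f) \<cdot> ?a) \<lhd> ?I) = ?a \<cdot> (\<r> (g \<star> f) \<lhd> ?I)" .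
  have "((g \<rhd> \<r> f) \<cdot> ?a) \<lhd> ?I = \<r> (g \<star> f) \<lhd> ?I"
    by (rule cancel_left [OF _ _ _ _ _ *]) auto
  then show "((g \<rhd> \<r> f) \<cdot> ?a) \<lhd> \<one> (src1 B ((g \<star> f) \<star> ?I))
      = \<r> (g \<star> f) \<lhd> \<one> (src1 B ((g \<star> f) \<star> ?I))"
    by simp
qed (simp_all add: hom2_iff)

section \<open>Squares\<close>

text \<open>The sides \<open>S\<close> and \<open>T\<close> are parameters and not components of the
  triple, because cells are formed only between squares with the same sides.\<close>

fun square :: "'a \<Rightarrow> 'a \<Rightarrow> 'a \<times> 'a \<times> 'c \<Rightarrow> bool" where
  "square S T (p, u, t) \<longleftrightarrow> S \<in> Arr B \<and> T \<in> Arr B \<and>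
     p \<in> hom1 B (trg1 B S) (trg1 B T) \<and> u \<in> hom1 B (src1 B S) (src1 B T) \<and>
     t \<in> hom2 B (p \<star> S) (T \<star> u)"

text \<open>The typing of both squares and both cells is part of the predicate, so that closure
  lemmas can be chained without separate typing hypotheses.\<close>

fun square_cell :: "'a \<Rightarrow> 'a \<Rightarrow> 'a \<times> 'a \<times> 'c \<Rightarrow> 'a \<times> 'a \<times> 'c \<Rightarrow> 'c \<Rightarrow> 'c \<Rightarrow> bool" where
  "square_cell S T (p, u, t) (p', u', t') \<pi> \<sigma> \<longleftrightarrow>
     square S T (p, u, t) \<and> square S T (p', u', t') \<and> \<pi> \<in> hom2 B p p' \<and> \<sigma> \<in> hom2 B u u' \<and>
     t' \<cdot> (\<pi> \<lhd> S) = (T \<rhd> \<sigma>) \<cdot> t"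

text \<open>For components of \<theta>, the resulting 2-cell is the part of the left side of LN2
  that is applied before the multiplication of \<open>F\<close>.\<close>

fun square_comp :: "'a \<Rightarrow> 'a \<Rightarrow> 'a \<Rightarrow> 'a \<times> 'a \<times> 'c \<Rightarrow> 'a \<times> 'a \<times> 'c \<Rightarrow> 'a \<times> 'a \<times> 'c" where
  "square_comp S T U (q, v, s) (p, u, t) =
     (q \<star> p, v \<star> u, \<a> U v u \<cdot> (s \<lhd> u) \<cdot> inv2 (\<a> q T u) \<cdot> (q \<rhd> t) \<cdot> \<a> q p S)"

text \<open>The 2-cell is the canonical isomorphism that replaces an identity on the left of
  \<open>T\<close> by one on the right. Up to unitors this square is the unit for pasting.\<close>

definition square_id :: "'a \<Rightarrow> 'a \<times> 'a \<times> 'c" where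
  "square_id T = (\<one> (trg1 B T), \<one> (src1 B T), inv2 (\<r> T) \<cdot> \<l> T)"

section \<open>Squares and their cells under vertical composition and pasting\<close>

lemma square_square_id: "T \<in> Arr B \<Longrightarrow> square T T (square_id T)"
  by (simp add: square_id_def hom1_iff hom2_iff)

lemma square_square_comp:
  assumes "square S T P" "square T U Q"
  shows "square S U (square_comp S T U Q P)"
proof -
  obtain p u t q v s where "P = (p, u, t)" "Q = (q, v, s)" by (cases P, cases Q)
  with assms show ?thesis by (simp add: hom1_iff hom2_iff)
qed

lemma square_cell_id:
  assumes "square S T P"
  shows "square_cell S T P P (\<iota> (fst P)) (\<iota> (fst (snd P)))"
proof -
  obtain p u t where "P = (p, u, t)" by (cases P)
  with assms show ?thesis by (simp add: hom1_iff hom2_iff)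
qed

lemma square_cell_vcomp:
  assumes "square_cell S T P P' \<pi> \<sigma>" "square_cell S T P' P'' \<pi>' \<sigma>'"
  shows "square_cell S T P P'' (\<pi>' \<cdot> \<pi>) (\<sigma>' \<cdot> \<sigma>)"
proof -
  obtain p u t p' u' t' p'' u'' t''
    where P: "P = (p, u, t)" "P' = (p', u', t')" "P'' = (p'', u'', t'')"
    by (cases P, cases P', cases P'')
  note typing = assms [unfolded P, simplified, unfolded hom1_iff hom2_iff]
  have 1: "(T \<rhd> \<sigma>) \<cdot> t = t' \<cdot> (\<pi> \<lhd> S)" and 2: "(T \<rhd> \<sigma>') \<cdot> t' = t'' \<cdot> (\<pi>' \<lhd> S)"
    using typing by auto
  have "((T \<rhd> \<sigma>') \<cdot> (T \<rhd> \<sigma>)) \<cdot> t = t'' \<cdot> (\<pi>' \<lhd> S) \<cdot> (\<pi> \<lhd> S)"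
    by (rule paste_squares [OF 2 1]) (use typing in simp_all)
  then have "t'' \<cdot> ((\<pi>' \<cdot> \<pi>) \<lhd> S) = (T \<rhd> (\<sigma>' \<cdot> \<sigma>)) \<cdot> t"
    using typing by (simp add: interchange' del: vcomp_assoc_simp)
  then show ?thesis
    using typing by (simp add: P hom1_iff hom2_iff)
qed

text \<open>The horizontal composite is moved past the five factors of the pasted 2-cell one at a
  time: naturality deals with the associators, and the conditions on the two given cells, combined
  with interchange, deal with \<open>t\<close> and \<open>s\<close>.\<close>

lemma square_cell_hcomp:
  assumes "square_cell S T P P' \<pi> \<sigma>" "square_cell T U Q Q' \<rho> \<tau>"
  shows "square_cell S U (square_comp S T U Q P) (square_comp S T U Q' P') (\<rho> \<ast> \<pi>) (\<tau> \<ast> \<sigma>)"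
proof -
  obtain p u t p' u' t' q v s q' v' s'
    where PQ: "P = (p, u, t)" "P' = (p', u', t')" "Q = (q, v, s)" "Q' = (q', v', s')"
    by (cases P, cases P', cases Q, cases Q')
  note typing = assms [unfolded PQ, simplified, unfolded hom1_iff hom2_iff]
  have 1: "\<a> q' p' S \<cdot> ((\<rho> \<ast> \<pi>) \<lhd> S) = (\<rho> \<ast> (\<pi> \<lhd> S)) \<cdot> \<a> q p S"
    using typing by (intro assoc_natural') (auto simp: hom2_iff)
  have 2: "(q' \<rhd> t') \<cdot> (\<rho> \<ast> (\<pi> \<lhd> S)) = (\<rho> \<ast> (T \<rhd> \<sigma>)) \<cdot> (q \<rhd> t)"
    using typing by (simp add: interchange')
  have 3: "inv2 (\<a> q' T u') \<cdot> (\<rho> \<ast> (T \<rhd> \<sigma>)) = ((\<rho> \<lhd> T) \<ast> \<sigma>) \<cdot> inv2 (\<a> q T u)"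
    using typing by (intro assoc_inv_natural) (auto simp: hom2_iff)
  have 4: "(s' \<lhd> u') \<cdot> ((\<rho> \<lhd> T) \<ast> \<sigma>) = ((U \<rhd> \<tau>) \<ast> \<sigma>) \<cdot> (s \<lhd> u)"
    using typing by (simp add: interchange')
  have 5: "\<a> U v' u' \<cdot> ((U \<rhd> \<tau>) \<ast> \<sigma>) = (U \<rhd> (\<tau> \<ast> \<sigma>)) \<cdot> \<a> U v u"
    using typing by (intro assoc_natural') (auto simp: hom2_iff)
  note a = paste_squares [OF 2 1]
  note b = paste_squares [OF 3 a]
  note c = paste_squares [OF 4 b]
  note d = paste_squares [OF 5 c]
  have "(\<a> U v' u' \<cdot> (s' \<lhd> u') \<cdot> inv2 (\<a> q' T u') \<cdot> (q' \<rhd> t') \<cdot> \<a> q' p' S) \<cdot> ((\<rho> \<ast> \<pi>) \<lhd> S)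
      = (U \<rhd> (\<tau> \<ast> \<sigma>)) \<cdot> (\<a> U v u \<cdot> (s \<lhd> u) \<cdot> inv2 (\<a> q T u) \<cdot> (q \<rhd> t) \<cdot> \<a> q p S)"
    by (rule d) (use typing in simp_all)
  then show ?thesis
    using typing by (simp add: PQ hom1_iff hom2_iff)
qed

text \<open>Pasting with \<open>square_id\<close> adds the factor
  \<open>inv2 (\<r> T) \<cdot> \<l> T\<close>. The triangle cancels its right unitor;
  \<open>lunit_comp\<close> at both ends and naturality of \<open>\<l>\<close> then carry the left
  unitor past \<open>t\<close>.\<close>

lemma square_cell_lunit:
  assumes "square S T P"
  shows "square_cell S T (square_comp S T T (square_id T) P) P (\<l> (fst P)) (\<l> (fst (snd P)))"
proof -
  obtain p u t where P: "P = (p, u, t)" by (cases P)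
  note typing = assms [unfolded P, simplified, unfolded hom1_iff hom2_iff]
  let ?I = "\<one> (trg1 B T)" and ?J = "\<one> (src1 B T)"
  have t: "\<l> (T \<star> u) \<cdot> (?I \<rhd> t) = t \<cdot> \<l> (p \<star> S)"
    using typing by (intro lunit_natural') (auto simp: hom2_iff)
  have 1: "\<l> (T \<star> u) \<cdot> \<a> ?I T u = \<l> T \<lhd> u" and 2: "\<l> (p \<star> S) \<cdot> \<a> ?I p S = \<l> p \<lhd> S"
    using typing lunit_comp [of u T] lunit_comp [of S p] by simp_all
  have 3: "(T \<rhd> \<l> u) \<cdot> \<a> T ?J u = \<r> T \<lhd> u"
    using typing by (intro triangle') auto
  have "(T \<rhd> \<l> u) \<cdot> (\<a> T ?J u \<cdot> ((inv2 (\<r> T) \<cdot> \<l> T) \<lhd> u) \<cdot> inv2 (\<a> ?I T u) \<cdot> (?I \<rhd> t) \<cdot> \<a> ?I p S)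
      = ((T \<rhd> \<l> u) \<cdot> \<a> T ?J u) \<cdot> ((inv2 (\<r> T) \<cdot> \<l> T) \<lhd> u) \<cdot> inv2 (\<a> ?I T u) \<cdot> (?I \<rhd> t) \<cdot> \<a> ?I p S"
    using typing by simp
  also have "\<dots> = ((\<r> T \<lhd> u) \<cdot> ((inv2 (\<r> T) \<cdot> \<l> T) \<lhd> u)) \<cdot> inv2 (\<a> ?I T u) \<cdot> (?I \<rhd> t) \<cdot> \<a> ?I p S"
    unfolding 3 using typing by simp
  also have "\<dots> = (\<l> T \<lhd> u) \<cdot> inv2 (\<a> ?I T u) \<cdot> (?I \<rhd> t) \<cdot> \<a> ?I p S"
    using typing by (simp add: interchange')
  also have "\<dots> = (\<l> (T \<star> u) \<cdot> (?I \<rhd> t)) \<cdot> \<a> ?I p S"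
    unfolding 1 [symmetric] using typing by simp
  also have "\<dots> = t \<cdot> (\<l> p \<lhd> S)"
    unfolding t 2 [symmetric] using typing by simp
  finally show ?thesis
    using typing by (simp add: P square_id_def hom1_iff hom2_iff)
qed

text \<open>The mirror image: \<open>runit_comp\<close> at both ends and naturality of
  \<open>\<r>\<close> carry the right unitor past \<open>t\<close>, and the triangle turns the
  remaining \<open>\<l> S\<close> into \<open>\<r> p\<close>.\<close>

lemma square_cell_runit:
  assumes "square S T P"
  shows "square_cell S T (square_comp S S T P (square_id S)) P (\<r> (fst P)) (\<r> (fst (snd P)))"
proof -
  obtain p u t where P: "P = (p, u, t)" by (cases P)
  note typing = assms [unfolded P, simplified, unfolded hom1_iff hom2_iff]
  let ?I = "\<one> (trg1 B S)" and ?J = "\<one> (src1 B S)"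
  have t: "\<r> (T \<star> u) \<cdot> (t \<lhd> ?J) = t \<cdot> \<r> (p \<star> S)"
    using typing by (intro runit_natural') (auto simp: hom2_iff)
  have 1: "(T \<rhd> \<r> u) \<cdot> \<a> T u ?J = \<r> (T \<star> u)" and 2: "(p \<rhd> \<r> S) \<cdot> \<a> p S ?J = \<r> (p \<star> S)"
    using typing runit_comp [of u T] runit_comp [of S p] by simp_all
  have 3: "(p \<rhd> \<l> S) \<cdot> \<a> p ?I S = \<r> p \<lhd> S"
    using typing by (intro triangle') auto
  let ?rest = "(p \<rhd> (inv2 (\<r> S) \<cdot> \<l> S)) \<cdot> \<a> p ?I S"
  have "(T \<rhd> \<r> u) \<cdot> (\<a> T u ?J \<cdot> (t \<lhd> ?J) \<cdot> inv2 (\<a> p S ?J) \<cdot> ?rest)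
      = ((T \<rhd> \<r> u) \<cdot> \<a> T u ?J) \<cdot> (t \<lhd> ?J) \<cdot> inv2 (\<a> p S ?J) \<cdot> ?rest"
    using typing by simp
  also have "\<dots> = (\<r> (T \<star> u) \<cdot> (t \<lhd> ?J)) \<cdot> inv2 (\<a> p S ?J) \<cdot> ?rest"
    unfolding 1 using typing by simp
  also have "\<dots> = t \<cdot> ((p \<rhd> \<r> S) \<cdot> (p \<rhd> (inv2 (\<r> S) \<cdot> \<l> S))) \<cdot> \<a> p ?I S"
    unfolding t 2 [symmetric] using typing by simp
  also have "\<dots> = t \<cdot> (p \<rhd> \<l> S) \<cdot> \<a> p ?I S"
    using typing by (simp add: interchange')
  also have "\<dots> = t \<cdot> (\<r> p \<lhd> S)"
    unfolding 3 ..
  finally show ?thesis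
    using typing by (simp add: P square_id_def hom1_iff hom2_iff)
qed

text \<open>Phrased with projections, so that nested composites of squares need not be unfolded into
  triples.\<close>

lemma square_cellI:
  assumes "square S T P" "square S T P'" "\<pi> \<in> hom2 B (fst P) (fst P')"
    "\<sigma> \<in> hom2 B (fst (snd P)) (fst (snd P'))"
    "snd (snd P') \<cdot> (\<pi> \<lhd> S) = (T \<rhd> \<sigma>) \<cdot> snd (snd P)"
  shows "square_cell S T P P' \<pi> \<sigma>"
proof -
  obtain p u t p' u' t' where "P = (p, u, t)" "P' = (p', u', t')" by (cases P, cases P')
  with assms show ?thesis by simp
qed

text \<open>
  The bracketings on the right-hand sides are those produced by pasting the seven squares in
  \<open>square_cell_assoc\<close>. Checking the typing conditions on variables first keeps the simplifier from
  exponential blow-up there.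
\<close>

lemma lwhisker_chain:
  assumes "\<alpha> \<in> Cell B" "\<beta> \<in> Cell B" "\<gamma> \<in> Cell B" "e1 \<in> Cell B" "e2 \<in> Cell B" "e3 \<in> Cell B"
    "e4 \<in> Cell B" "e5 \<in> Cell B" "\<delta> \<in> Cell B" "f \<in> Arr B"
    "src2 B \<alpha> = trg2 B \<beta>" "src2 B \<beta> = trg2 B \<gamma>" "src2 B \<gamma> = f \<star> trg2 B e1"
    "src2 B e1 = trg2 B e2" "src2 B e2 = trg2 B e3" "src2 B e3 = trg2 B e4" "src2 B e4 = trg2 B e5"
    "f \<star> src2 B e5 = trg2 B \<delta>" "src1 B f = trg1 B (src2 B e5)"
  shows "\<alpha> \<cdot> \<beta> \<cdot> \<gamma> \<cdot> (f \<rhd> (e1 \<cdot> e2 \<cdot> e3 \<cdot> e4 \<cdot> e5)) \<cdot> \<delta>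
    = \<alpha> \<cdot> \<beta> \<cdot> (\<gamma> \<cdot> (f \<rhd> e1)) \<cdot> (f \<rhd> e2) \<cdot> (f \<rhd> e3) \<cdot> (f \<rhd> e4) \<cdot> ((f \<rhd> e5) \<cdot> \<delta>)"
proof -
  have t: "trg1 B (src2 B e4) = trg1 B (src2 B e5)" "trg1 B (src2 B e3) = trg1 B (src2 B e5)"
    "trg1 B (src2 B e2) = trg1 B (src2 B e5)" "trg1 B (src2 B e1) = trg1 B (src2 B e5)"
    using assms by simp_all
  show ?thesis using assms t by (simp add: lwhisker_vcomp)
qed

lemma rwhisker_chain:
  assumes "\<alpha> \<in> Cell B" "\<beta> \<in> Cell B" "\<gamma> \<in> Cell B" "e1 \<in> Cell B" "e2 \<in> Cell B" "e3 \<in> Cell B"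
    "e4 \<in> Cell B" "e5 \<in> Cell B" "\<delta> \<in> Cell B" "f \<in> Arr B"
    "src2 B \<alpha> = trg2 B e1 \<star> f"
    "src2 B e1 = trg2 B e2" "src2 B e2 = trg2 B e3" "src2 B e3 = trg2 B e4" "src2 B e4 = trg2 B e5"
    "src2 B e5 \<star> f = trg2 B \<beta>" "src2 B \<beta> = trg2 B \<gamma>" "src2 B \<gamma> = trg2 B \<delta>"
    "trg1 B f = src1 B (src2 B e5)"
  shows "\<alpha> \<cdot> ((e1 \<cdot> e2 \<cdot> e3 \<cdot> e4 \<cdot> e5) \<lhd> f) \<cdot> \<beta> \<cdot> \<gamma> \<cdot> \<delta>
    = (\<alpha> \<cdot> (e1 \<lhd> f)) \<cdot> (e2 \<lhd> f) \<cdot> (e3 \<lhd> f) \<cdot> (e4 \<lhd> f) \<cdot> ((e5 \<lhd> f) \<cdot> \<beta>) \<cdot> \<gamma> \<cdot> \<delta>"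
proof -
  have t: "src1 B (src2 B e4) = src1 B (src2 B e5)" "src1 B (src2 B e3) = src1 B (src2 B e5)"
    "src1 B (src2 B e2) = src1 B (src2 B e5)" "src1 B (src2 B e1) = src1 B (src2 B e5)"
    using assms by simp_all
  show ?thesis using assms t by (simp add: rwhisker_vcomp)
qed

text \<open>The two pasted 2-cells are the columns of a ladder whose rungs are associators,
  whiskered at the two ends. Of its seven squares, 1, 3, 5 and 7 are pentagons, and 2, 4 and 6 are
  naturality of the associator.\<close>

lemma square_cell_assoc:
  assumes "square S T P" "square T U Q" "square U V R"
  shows "square_cell S V (square_comp S T V (square_comp T U V R Q) P)
    (square_comp S U V R (square_comp S T U Q P))
    (\<a> (fst R) (fst Q) (fst P)) (\<a> (fst (snd R)) (fst (snd Q)) (fst (snd P)))"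
proof -
  obtain p u t q v s m w r where PQR: "P = (p, u, t)" "Q = (q, v, s)" "R = (m, w, r)"
    by (cases P, cases Q, cases R)
  note typing = assms [unfolded PQR, simplified, unfolded hom1_iff hom2_iff]
  have 1: "((m \<rhd> \<a> q p S) \<cdot> \<a> m (q \<star> p) S) \<cdot> (\<a> m q p \<lhd> S) = \<a> m q (p \<star> S) \<cdot> \<a> (m \<star> q) p S"
    using typing by (simp add: pentagon')
  have 2: "(m \<rhd> (q \<rhd> t)) \<cdot> \<a> m q (p \<star> S) = \<a> m q (T \<star> u) \<cdot> ((m \<star> q) \<rhd> t)"
    using typing assoc_natural' [of t "p \<star> S" "T \<star> u" "\<iota> q" q q "\<iota> m" m m] by (simp add: hom2_iff)
  \<comment> \<open>Pasted cells contain inverse associators, so here and in 5 the pentagon is used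
    with two opposite sides reversed.\<close>
  have 3: "(m \<rhd> inv2 (\<a> q T u)) \<cdot> \<a> m q (T \<star> u)
      = \<a> m (q \<star> T) u \<cdot> (\<a> m q T \<lhd> u) \<cdot> inv2 (\<a> (m \<star> q) T u)"
    using typing pentagon' [of u T q m]
      inverse_square [of "\<a> m q (T \<star> u)" "\<a> (m \<star> q) T u" "m \<rhd> \<a> q T u" "\<a> m (q \<star> T) u \<cdot> (\<a> m q T \<lhd> u)"]
    by (simp add: inv2_lwhisker)
  have 4: "(m \<rhd> (s \<lhd> u)) \<cdot> \<a> m (q \<star> T) u = \<a> m (U \<star> v) u \<cdot> ((m \<rhd> s) \<lhd> u)"
    using typing assoc_natural' [of "\<iota> u" u u s "q \<star> T" "U \<star> v" "\<iota> m" m m] by (simp add: hom2_iff)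
  have 5: "(inv2 (\<a> m U (v \<star> u)) \<cdot> (m \<rhd> \<a> U v u)) \<cdot> \<a> m (U \<star> v) u
      = \<a> (m \<star> U) v u \<cdot> (inv2 (\<a> m U v) \<lhd> u)"
    using typing pentagon' [of u v U m]
      inverse_square [of "(m \<rhd> \<a> U v u) \<cdot> \<a> m (U \<star> v) u" "\<a> m U v \<lhd> u" "\<a> m U (v \<star> u)" "\<a> (m \<star> U) v u"]
    by (simp add: inv2_rwhisker)
  have 6: "(r \<lhd> (v \<star> u)) \<cdot> \<a> (m \<star> U) v u = \<a> (V \<star> w) v u \<cdot> ((r \<lhd> v) \<lhd> u)"
    using typing assoc_natural' [of "\<iota> u" u u "\<iota> v" v v r "m \<star> U" "V \<star> w"] by (simp add: hom2_iff)
  have 7: "\<a> V w (v \<star> u) \<cdot> \<a> (V \<star> w) v u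
      = (V \<rhd> \<a> w v u) \<cdot> (\<a> V (w \<star> v) u \<cdot> (\<a> V w v \<lhd> u))"
    using typing by (simp add: pentagon')
  note a = paste_squares [OF 2 1]
  note b = paste_squares [OF 3 a]
  note c = paste_squares [OF 4 b]
  note d = paste_squares [OF 5 c]
  note e = paste_squares [OF 6 d]
  note f = paste_squares [OF 7 e]
  have "(\<a> V w (v \<star> u) \<cdot> (r \<lhd> (v \<star> u)) \<cdot> (inv2 (\<a> m U (v \<star> u)) \<cdot> (m \<rhd> \<a> U v u)) \<cdot> (m \<rhd> (s \<lhd> u))
        \<cdot> (m \<rhd> inv2 (\<a> q T u)) \<cdot> (m \<rhd> (q \<rhd> t)) \<cdot> ((m \<rhd> \<a> q p S) \<cdot> \<a> m (q \<star> p) S)) \<cdot> (\<a> m q p \<lhd> S)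
      = (V \<rhd> \<a> w v u) \<cdot> (\<a> V (w \<star> v) u \<cdot> (\<a> V w v \<lhd> u)) \<cdot> ((r \<lhd> v) \<lhd> u) \<cdot> (inv2 (\<a> m U v) \<lhd> u)
        \<cdot> ((m \<rhd> s) \<lhd> u) \<cdot> ((\<a> m q T \<lhd> u) \<cdot> inv2 (\<a> (m \<star> q) T u)) \<cdot> ((m \<star> q) \<rhd> t) \<cdot> \<a> (m \<star> q) p S"
    by (rule f) (use typing in simp_all)
  \<comment> \<open>The columns come out of the pasting with their factors whiskered separately;
    gathering these shows each column to be the 2-cell of an iterated composite of squares.\<close>
  also have "\<a> V w (v \<star> u) \<cdot> (r \<lhd> (v \<star> u)) \<cdot> (inv2 (\<a> m U (v \<star> u)) \<cdot> (m \<rhd> \<a> U v u)) \<cdot> (m \<rhd> (s \<lhd> u))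
        \<cdot> (m \<rhd> inv2 (\<a> q T u)) \<cdot> (m \<rhd> (q \<rhd> t)) \<cdot> ((m \<rhd> \<a> q p S) \<cdot> \<a> m (q \<star> p) S)
      = \<a> V w (v \<star> u) \<cdot> (r \<lhd> (v \<star> u)) \<cdot> inv2 (\<a> m U (v \<star> u))
        \<cdot> (m \<rhd> (\<a> U v u \<cdot> (s \<lhd> u) \<cdot> inv2 (\<a> q T u) \<cdot> (q \<rhd> t) \<cdot> \<a> q p S)) \<cdot> \<a> m (q \<star> p) S"
    by (rule lwhisker_chain [symmetric]) (use typing in simp_all)
  also have "(\<a> V (w \<star> v) u \<cdot> (\<a> V w v \<lhd> u)) \<cdot> ((r \<lhd> v) \<lhd> u) \<cdot> (inv2 (\<a> m U v) \<lhd> u)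
        \<cdot> ((m \<rhd> s) \<lhd> u) \<cdot> ((\<a> m q T \<lhd> u) \<cdot> inv2 (\<a> (m \<star> q) T u)) \<cdot> ((m \<star> q) \<rhd> t) \<cdot> \<a> (m \<star> q) p S
      = \<a> V (w \<star> v) u \<cdot> ((\<a> V w v \<cdot> (r \<lhd> v) \<cdot> inv2 (\<a> m U v) \<cdot> (m \<rhd> s) \<cdot> \<a> m q T) \<lhd> u)
        \<cdot> inv2 (\<a> (m \<star> q) T u) \<cdot> ((m \<star> q) \<rhd> t) \<cdot> \<a> (m \<star> q) p S"
    by (rule rwhisker_chain [symmetric]) (use typing in simp_all)
  finally have *: "snd (snd (square_comp S U V R (square_comp S T U Q P))) \<cdot> (\<a> (fst R) (fst Q) (fst P) \<lhd> S)
      = (V \<rhd> \<a> (fst (snd R)) (fst (snd Q)) (fst (snd P))) \<cdot> snd (snd (square_comp S T V (square_comp T U V R Q) P))"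
    unfolding PQR square_comp.simps fst_conv snd_conv .
  show ?thesis
  proof (rule square_cellI)
    show "square S V (square_comp S T V (square_comp T U V R Q) P)"
      "square S V (square_comp S U V R (square_comp S T U Q P))"
      using assms by (blast intro: square_square_comp)+
    show "\<a> (fst R) (fst Q) (fst P)
        \<in> hom2 B (fst (square_comp S T V (square_comp T U V R Q) P))
            (fst (square_comp S U V R (square_comp S T U Q P)))"
      "\<a> (fst (snd R)) (fst (snd Q)) (fst (snd P))
        \<in> hom2 B (fst (snd (square_comp S T V (square_comp T U V R Q) P)))
            (fst (snd (square_comp S U V R (square_comp S T U Q P))))"
      using typing by (simp_all add: PQR hom2_iff)
  qed (rule *)
qed

section \<open>Unique lifting of 2-cells along invertible squares\<close>

definition iso_square :: "'a \<Rightarrow> 'a \<Rightarrow> 'a \<times> 'a \<times> 'c \<Rightarrow> bool" where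
  "iso_square S T P \<longleftrightarrow> square S T P \<and> iso_cell (snd (snd P))"

lemma iso_square_id: "T \<in> Arr B \<Longrightarrow> iso_square T T (square_id T)"
  by (simp add: iso_square_def square_square_id) (simp add: square_id_def)

lemma iso_square_comp:
  assumes "iso_square S T P" "iso_square T U Q"
  shows "iso_square S U (square_comp S T U Q P)"
proof -
  obtain p u t q v s where "P = (p, u, t)" "Q = (q, v, s)" by (cases P, cases Q)
  with assms show ?thesis by (simp add: iso_square_def hom1_iff hom2_iff)
qed

text \<open>Invertibility of \<open>t\<close> allows the condition on a cell to be solved for
  \<open>T \<rhd> \<sigma>\<close>, which must be
  \<open>t' \<cdot> (\<pi> \<lhd> S) \<cdot> inv2 t\<close>; fullness supplies
  \<open>\<sigma>\<close>.\<close>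

lemma square_cell_lift_exists:
  assumes "iso_square S T P" "square S T P'" "postcomp_full B T (src1 B S)"
    "\<pi> \<in> hom2 B (fst P) (fst P')"
  obtains \<sigma> where "square_cell S T P P' \<pi> \<sigma>"
proof -
  obtain p u t p' u' t' where P: "P = (p, u, t)" "P' = (p', u', t')" by (cases P, cases P')
  note typing = assms(1,2,4) [unfolded P iso_square_def, simplified, unfolded hom1_iff hom2_iff]
  have "t' \<cdot> (\<pi> \<lhd> S) \<cdot> inv2 t \<in> hom2 B (T \<star> u) (T \<star> u')"
    using typing by (simp add: hom2_iff)
  moreover have "u \<in> hom1 B (src1 B S) (src1 B T)" "u' \<in> hom1 B (src1 B S) (src1 B T)"
    using typing by (simp_all add: hom1_iff)
  ultimately obtain \<sigma> where \<sigma>: "\<sigma> \<in> hom2 B u u'" "T \<rhd> \<sigma> = t' \<cdot> (\<pi> \<lhd> S) \<cdot> inv2 t"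
    using assms(3) unfolding postcomp_full_def by blast
  have "square_cell S T P P' \<pi> \<sigma>"
    using typing \<sigma>(1) by (simp add: P hom1_iff hom2_iff \<sigma>(2))
  then show thesis by (rule that)
qed

text \<open>Cancelling \<open>t\<close> on the right gives
  \<open>T \<rhd> \<sigma> = T \<rhd> \<sigma>'\<close>, and faithfulness removes
  \<open>T\<close>.\<close>

lemma square_cell_lift_unique:
  assumes "iso_square S T P" "postcomp_faithful B T (src1 B S)"
    "square_cell S T P P' \<pi> \<sigma>" "square_cell S T P P' \<pi> \<sigma>'"
  shows "\<sigma> = \<sigma>'"
proof -
  obtain p u t p' u' t' where P: "P = (p, u, t)" "P' = (p', u', t')" by (cases P, cases P')
  note typing = assms(1,3,4) [unfolded P iso_square_def, simplified, unfolded hom1_iff hom2_iff]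
  have "T \<rhd> \<sigma> = T \<rhd> \<sigma>'"
    by (rule cancel_right [of t]) (use typing in simp_all)
  moreover have "\<sigma> \<in> hom2 B u u'" "\<sigma>' \<in> hom2 B u u'"
    "u \<in> hom1 B (src1 B S) (src1 B T)" "u' \<in> hom1 B (src1 B S) (src1 B T)"
    using typing by (simp_all add: hom1_iff hom2_iff)
  ultimately show ?thesis
    using assms(2) unfolding postcomp_faithful_def inj_on_def by blast
qed

text \<open>A lift \<open>\<sigma>'\<close> of \<open>inv2 \<pi>\<close> is the inverse: both
  composites of \<open>\<sigma>\<close> and \<open>\<sigma>'\<close> lie over identities, as
  identities do, so uniqueness of lifts applies.\<close>

lemma square_cell_iso:
  assumes "iso_square S T P" "iso_square S T P'"
    and full: "postcomp_full B T (src1 B S)" and faithful: "postcomp_faithful B T (src1 B S)"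
    and cell: "square_cell S T P P' \<pi> \<sigma>" and "iso_cell \<pi>"
  shows "iso_cell \<sigma>"
proof -
  have *: "square S T P" "square S T P'" using assms by (simp_all add: iso_square_def)
  obtain p u t p' u' t' where P: "P = (p, u, t)" "P' = (p', u', t')" by (cases P, cases P')
  have \<pi>: "\<pi> \<in> Cell B" "src2 B \<pi> = fst P" "trg2 B \<pi> = fst P'"
    using cell by (auto simp: P hom2_iff)
  have "inv2 \<pi> \<in> hom2 B (fst P') (fst P)"
    using \<pi> \<open>iso_cell \<pi>\<close> by (simp add: hom2_iff)
  then obtain \<sigma>' where inv: "square_cell S T P' P (inv2 \<pi>) \<sigma>'"
    using square_cell_lift_exists [OF assms(2) *(1) full] by blast
  have "square_cell S T P P (\<iota> (fst P)) (\<sigma>' \<cdot> \<sigma>)"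
    using square_cell_vcomp [OF cell inv] \<pi> \<open>iso_cell \<pi>\<close> by simp
  then have "\<sigma>' \<cdot> \<sigma> = \<iota> u"
    using square_cell_lift_unique [OF assms(1) faithful _ square_cell_id [OF *(1)]] P by simp
  moreover have "square_cell S T P' P' (\<iota> (fst P')) (\<sigma> \<cdot> \<sigma>')"
    using square_cell_vcomp [OF inv cell] \<pi> \<open>iso_cell \<pi>\<close> by simp
  then have "\<sigma> \<cdot> \<sigma>' = \<iota> u'"
    using square_cell_lift_unique [OF assms(2) faithful _ square_cell_id [OF *(2)]] P by simp
  ultimately show ?thesis
    using cell inv by (intro iso_cellI [where \<beta> = \<sigma>']) (simp_all add: P hom2_iff)
qed

end

section \<open>Transfer along a pseudo transformation\<close>

locale transfer_datum = preAssg_lax_transformation B D F0 F1 G0 G1 T0 T1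
  for B :: "('o, 'a, 'c) bicat" and D :: "('p, 'b, 'd) bicat" (structure)
    and F0 F1 G0 G1 T0 T1 +
  assumes invertible: "invertible_components B D F1 G1 T0 T1"
    and transfer_condition: "transfer_condition B D F0 T0"
begin

section \<open>The components of \<theta> as invertible squares\<close>

abbreviation sq :: "'a \<Rightarrow> 'b \<times> 'b \<times> 'd" where
  "sq f \<equiv> (G1 f, F1 f, T1 f)"

abbreviation cell_over where
  "cell_over X Y \<equiv> bicategory.square_cell D (T0 X) (T0 Y)"

lemma T0_simps [simp]:
  "X \<in> Obj B \<Longrightarrow> T0 X \<in> Arr D" "X \<in> Obj B \<Longrightarrow> src1 D (T0 X) = F0 X"
  "X \<in> Obj B \<Longrightarrow> trg1 D (T0 X) = G0 X"
  using T0_hom by (auto simp: F.target.hom1_iff)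

lemma hom1_Obj: "f \<in> hom1 B X Y \<Longrightarrow> X \<in> Obj B \<and> Y \<in> Obj B"
  using F.source.src1_Obj F.source.trg1_Obj by (auto simp: hom1_def)

lemma iso_square_sq:
  assumes "f \<in> hom1 B X Y"
  shows "F.target.iso_square (T0 X) (T0 Y) (sq f)"
  using assms T1_hom [OF assms] F.F1_hom [OF assms] G.F1_hom [OF assms] hom1_Obj [OF assms] invertible
  by (auto simp: F.target.iso_square_def invertible_components_def F.target.iso2_iff)

lemma square_sq: "f \<in> hom1 B X Y \<Longrightarrow> F.target.square (T0 X) (T0 Y) (sq f)"
  using iso_square_sq unfolding F.target.iso_square_def by blast

text \<open>The source of \<open>T0 X\<close> is \<open>F0 X\<close>, which lies in the image of
  \<open>F\<close>; this is where the transfer condition grants fullness of postcomposition with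
  \<open>T0 Y\<close>.\<close>

lemma cell_over_exists:
  assumes "X \<in> Obj B" "Y \<in> Obj B" "F.target.iso_square (T0 X) (T0 Y) P" "F.target.square (T0 X) (T0 Y) P'"
    "\<pi> \<in> hom2 D (fst P) (fst P')"
  shows "\<exists>\<sigma>. cell_over X Y P P' \<pi> \<sigma>"
proof -
  have "postcomp_full D (T0 Y) (src1 D (T0 X))"
    using transfer_condition assms(1,2) unfolding transfer_condition_def by simp
  from F.target.square_cell_lift_exists [OF assms(3,4) this assms(5)] show ?thesis by blast
qed

lemma cell_over_unique:
  assumes "X \<in> Obj B" "Y \<in> Obj B" "F.target.iso_square (T0 X) (T0 Y) P"
    "cell_over X Y P P' \<pi> \<sigma>" "cell_over X Y P P' \<pi> \<sigma>'"
  shows "\<sigma> = \<sigma>'"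
proof -
  have "postcomp_faithful D (T0 Y) (src1 D (T0 X))"
    using transfer_condition assms(1,2) unfolding transfer_condition_def by simp
  from F.target.square_cell_lift_unique [OF assms(3) this assms(4,5)] show ?thesis .
qed

lemma cell_over_iso:
  assumes "X \<in> Obj B" "Y \<in> Obj B"
    "F.target.iso_square (T0 X) (T0 Y) P" "F.target.iso_square (T0 X) (T0 Y) P'"
    "cell_over X Y P P' \<pi> \<sigma>" "F.target.iso_cell \<pi>"
  shows "F.target.iso_cell \<sigma>"
proof -
  have "postcomp_full D (T0 Y) (src1 D (T0 X))" "postcomp_faithful D (T0 Y) (src1 D (T0 X))"
    using transfer_condition assms(1,2) unfolding transfer_condition_def by simp_all
  from F.target.square_cell_iso [OF assms(3,4) this assms(5,6)] show ?thesis .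
qed

section \<open>The transformation axioms as conditions on cells of squares\<close>

lemma LN0_iff:
  assumes "f \<in> hom1 B X Y" "\<alpha> \<in> hom2 B f g"
    "G2 \<alpha> \<in> hom2 D (G1 f) (G1 g)" "F2 \<alpha> \<in> hom2 D (F1 f) (F1 g)"
  shows "cell_over X Y (sq f) (sq g) (G2 \<alpha>) (F2 \<alpha>)
    \<longleftrightarrow> T1 g \<cdot> (G2 \<alpha> \<lhd> T0 X) = (T0 Y \<rhd> F2 \<alpha>) \<cdot> T1 f"
  using assms square_sq [OF assms(1)] square_sq [OF F.source.hom2_hom1 [OF assms(2,1)]] by simp

text \<open>Composing LN1 on the right with the invertible \<open>\<l> (T0 X)\<close> gives the
  condition on a cell out of \<open>square_id\<close>.\<close>

lemma LN1_iff:
  assumes "X \<in> Obj B" "xG \<in> hom2 D (\<one> (G0 X)) (G1 (\<one>\<^bsub>B\<^esub> X))" "xF \<in> hom2 D (\<one> (F0 X)) (F1 (\<one>\<^bsub>B\<^esub> X))"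
  shows "cell_over X X (F.target.square_id (T0 X)) (sq (\<one>\<^bsub>B\<^esub> X)) xG xF
    \<longleftrightarrow> (T0 X \<rhd> xF) \<cdot> inv2 (\<r> (T0 X)) = T1 (\<one>\<^bsub>B\<^esub> X) \<cdot> (xG \<lhd> T0 X) \<cdot> inv2 (\<l> (T0 X))"
    (is "?L \<longleftrightarrow> ?a = ?b")
proof -
  have one: "\<one>\<^bsub>B\<^esub> X \<in> hom1 B X X" using assms(1) by (rule F.source.id1_hom)
  have T1: "T1 (\<one>\<^bsub>B\<^esub> X) \<in> Cell D" "src2 D (T1 (\<one>\<^bsub>B\<^esub> X)) = G1 (\<one>\<^bsub>B\<^esub> X) \<star> T0 X"
    "trg2 D (T1 (\<one>\<^bsub>B\<^esub> X)) = T0 X \<star> F1 (\<one>\<^bsub>B\<^esub> X)"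
    using T1_hom [OF one] by (auto simp: F.target.hom2_iff)
  have x: "xG \<in> Cell D" "src2 D xG = \<one> (G0 X)" "trg2 D xG = G1 (\<one>\<^bsub>B\<^esub> X)"
    "xF \<in> Cell D" "src2 D xF = \<one> (F0 X)" "trg2 D xF = F1 (\<one>\<^bsub>B\<^esub> X)"
    using assms by (auto simp: F.target.hom2_iff)
  have [simp]: "F0 X \<in> Obj D" "G0 X \<in> Obj D" using assms(1) F.F0_Obj G.F0_Obj by auto
  have "?L \<longleftrightarrow> T1 (\<one>\<^bsub>B\<^esub> X) \<cdot> (xG \<lhd> T0 X) = (T0 X \<rhd> xF) \<cdot> inv2 (\<r> (T0 X)) \<cdot> \<l> (T0 X)"
    using assms square_sq [OF one] F.target.square_square_id [of "T0 X"]
    by (simp add: F.target.square_id_def)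
  also have "\<dots> \<longleftrightarrow> ?b \<cdot> \<l> (T0 X) = ?a \<cdot> \<l> (T0 X)"
    using assms(1) T1 x by simp
  also have "\<dots> \<longleftrightarrow> ?a = ?b"
    using F.target.cancel_right [of "\<l> (T0 X)" ?b ?a] assms(1) T1 x
    by (auto simp del: F.target.vcomp_assoc_simp)
  finally show ?thesis .
qed

text \<open>Unfolding \<open>square_comp\<close> produces LN2 with its two sides exchanged.\<close>

lemma LN2_iff:
  assumes "f \<in> hom1 B X Y" "g \<in> hom1 B Y Z"
    "yG \<in> hom2 D (G1 g \<star> G1 f) (G1 (g \<star>\<^bsub>B\<^esub> f))" "yF \<in> hom2 D (F1 g \<star> F1 f) (F1 (g \<star>\<^bsub>B\<^esub> f))"
  shows "cell_over X Z (F.target.square_comp (T0 X) (T0 Y) (T0 Z) (sq g) (sq f)) (sq (g \<star>\<^bsub>B\<^esub> f)) yG yF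
    \<longleftrightarrow> (T0 Z \<rhd> yF) \<cdot> \<a> (T0 Z) (F1 g) (F1 f) \<cdot> (T1 g \<lhd> F1 f)
           \<cdot> inv2 (\<a> (G1 g) (T0 Y) (F1 f)) \<cdot> (G1 g \<rhd> T1 f) \<cdot> \<a> (G1 g) (G1 f) (T0 X)
         = T1 (g \<star>\<^bsub>B\<^esub> f) \<cdot> (yG \<lhd> T0 X)"
  using assms(3,4) square_sq [OF F.source.comp1_hom [OF assms(1,2)]]
    F.target.square_square_comp [OF square_sq [OF assms(1)] square_sq [OF assms(2)]]
  unfolding F.target.square_comp.simps F.target.square_cell.simps by auto

section \<open>Transfer of the assignment structure\<close>

lemma Assg_cell_over:
  assumes "Assg_lax_transformation B D F0 F1 F2 G0 G1 G2 T0 T1" "f \<in> hom1 B X Y" "\<alpha> \<in> hom2 B f g"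
  shows "cell_over X Y (sq f) (sq g) (G2 \<alpha>) (F2 \<alpha>)"
proof -
  interpret A: Assg_lax_transformation B D F0 F1 F2 G0 G1 G2 T0 T1 by (rule assms)
  show ?thesis
    using A.LN0 [OF assms(2,3)] A.F.F2_hom [OF assms(3)] A.G.F2_hom [OF assms(3)] LN0_iff assms by blast
qed

lemma Assg_unique:
  assumes "Assg_lax_transformation B D F0 F1 F2 G0 G1 G2 T0 T1"
    "Assg_lax_transformation B D F0 F1 F2' G0 G1 G2 T0 T1"
  shows "same_cell_map B F2 F2'"
  unfolding same_cell_map_def
proof
  fix \<alpha> assume \<alpha>: "\<alpha> \<in> Cell B"
  define f where "f = src2 B \<alpha>"
  have f: "f \<in> hom1 B (src1 B f) (trg1 B f)" "\<alpha> \<in> hom2 B f (trg2 B \<alpha>)"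
    using \<alpha> by (auto simp: f_def hom1_def hom2_def)
  show "F2 \<alpha> = F2' \<alpha>"
    using cell_over_unique [OF _ _ iso_square_sq [OF f(1)]
        Assg_cell_over [OF assms(1) f] Assg_cell_over [OF assms(2) f]]
      hom1_Obj [OF f(1)] by blast
qed

text \<open>Each \<open>F2 \<alpha>\<close> is a chosen lift of \<open>G2 \<alpha>\<close>. Since
  \<open>G2\<close> preserves identities and vertical composites, uniqueness of lifts forces
  \<open>F2\<close> to do the same.\<close>

lemma Assg_exists:
  assumes "assignment B D G0 G1 G2"
  shows "\<exists>F2. Assg_lax_transformation B D F0 F1 F2 G0 G1 G2 T0 T1"
proof -
  interpret G: assignment B D G0 G1 G2 by (rule assms)
  \<comment> \<open>The boundary is read off from \<open>\<alpha>\<close>, so that a single choice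
    over \<open>Cell B\<close> yields the whole map.\<close>
  let ?over = "\<lambda>\<alpha>. cell_over (src1 B (src2 B \<alpha>)) (trg1 B (src2 B \<alpha>)) (sq (src2 B \<alpha>)) (sq (trg2 B \<alpha>)) (G2 \<alpha>)"
  have "\<forall>\<alpha>\<in>Cell B. \<exists>\<sigma>. ?over \<alpha> \<sigma>"
  proof
    fix \<alpha> assume \<alpha>: "\<alpha> \<in> Cell B"
    have f: "src2 B \<alpha> \<in> hom1 B (src1 B (src2 B \<alpha>)) (trg1 B (src2 B \<alpha>))"
      and \<alpha>': "\<alpha> \<in> hom2 B (src2 B \<alpha>) (trg2 B \<alpha>)"
      using \<alpha> by (auto simp: hom1_def hom2_def)
    show "\<exists>\<sigma>. ?over \<alpha> \<sigma>"
      using hom1_Obj [OF f] iso_square_sq [OF f] square_sq [OF F.source.hom2_hom1 [OF \<alpha>' f]]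
        G.F2_hom [OF \<alpha>']
      by (intro cell_over_exists) auto
  qed
  then obtain F2 where F2: "\<forall>\<alpha>\<in>Cell B. ?over \<alpha> (F2 \<alpha>)"
    unfolding bchoice_iff by blast
  have over: "cell_over X Y (sq f) (sq g) (G2 \<alpha>) (F2 \<alpha>)"
    if "f \<in> hom1 B X Y" "\<alpha> \<in> hom2 B f g" for f X Y g \<alpha>
    using that F2 by (auto simp: hom1_def hom2_def)
  have Arr: "f \<in> hom1 B (src1 B f) (trg1 B f)" if "f \<in> Arr B" for f using that by (simp add: hom1_def)
  have src: "f \<in> hom1 B (src1 B f) (trg1 B f)" if "\<alpha> \<in> hom2 B f g" for \<alpha> f g
    using that by (auto simp: hom2_def intro: Arr)
  interpret F: assignment B D F0 F1 F2
  proof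
    fix \<alpha> f g assume \<alpha>: "\<alpha> \<in> hom2 B f g"
    show "F2 \<alpha> \<in> hom2 D (F1 f) (F1 g)" using over [OF src [OF \<alpha>] \<alpha>] by simp
  next
    fix f assume f: "f \<in> Arr B"
    note h = Arr [OF f] and i = F.source.id2_hom [OF f]
    show "F2 (\<iota>\<^bsub>B\<^esub> f) = \<iota> (F1 f)"
      using cell_over_unique [OF _ _ iso_square_sq [OF h] over [OF h i]]
        F.target.square_cell_id [OF square_sq [OF h]] hom1_Obj [OF h] G.F2_id [OF f] by simp
  next
    fix \<alpha> \<beta> f g h assume \<alpha>: "\<alpha> \<in> hom2 B f g" and \<beta>: "\<beta> \<in> hom2 B g h"
    note f = src [OF \<alpha>]
    note g = F.source.hom2_hom1 [OF \<alpha> f] and \<beta>\<alpha> = F.source.vcomp_hom [OF \<alpha> \<beta>]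
    show "F2 (\<beta> \<cdot>\<^bsub>B\<^esub> \<alpha>) = F2 \<beta> \<cdot> F2 \<alpha>"
      by (rule cell_over_unique [OF _ _ iso_square_sq [OF f] over [OF f \<beta>\<alpha>, unfolded G.F2_vcomp [OF \<alpha> \<beta>]]
          F.target.square_cell_vcomp [OF over [OF f \<alpha>] over [OF g \<beta>]]])
        (use hom1_Obj [OF f] in auto)
  qed
  have "Assg_lax_transformation B D F0 F1 F2 G0 G1 G2 T0 T1"
  proof
    fix f X Y \<alpha> g assume f: "f \<in> hom1 B X Y" and \<alpha>: "\<alpha> \<in> hom2 B f g"
    show "T1 g \<cdot> (G2 \<alpha> \<lhd> T0 X) = (T0 Y \<rhd> F2 \<alpha>) \<cdot> T1 f"
      using over [OF f \<alpha>] by simp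
  qed
  then show ?thesis by blast
qed

section \<open>Transfer of the unit and the multiplication\<close>

lemma laxFunc_cell_over_unit:
  assumes "laxFunc_lax_transformation B D F0 F1 F2 \<xi>F \<phi>F G0 G1 G2 \<xi>G \<phi>G T0 T1" "X \<in> Obj B"
  shows "cell_over X X (F.target.square_id (T0 X)) (sq (\<one>\<^bsub>B\<^esub> X)) (\<xi>G X) (\<xi>F X)"
proof -
  interpret A: laxFunc_lax_transformation B D F0 F1 F2 \<xi>F \<phi>F G0 G1 G2 \<xi>G \<phi>G T0 T1 by (rule assms)
  show ?thesis
    using A.LN1 A.F.unit_hom A.G.unit_hom LN1_iff assms(2) by blast
qed

lemma laxFunc_cell_over_mult:
  assumes "laxFunc_lax_transformation B D F0 F1 F2 \<xi>F \<phi>F G0 G1 G2 \<xi>G \<phi>G T0 T1"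
    "f \<in> hom1 B X Y" "g \<in> hom1 B Y Z"
  shows "cell_over X Z (F.target.square_comp (T0 X) (T0 Y) (T0 Z) (sq g) (sq f)) (sq (g \<star>\<^bsub>B\<^esub> f))
    (\<phi>G f g) (\<phi>F f g)"
proof -
  interpret A: laxFunc_lax_transformation B D F0 F1 F2 \<xi>F \<phi>F G0 G1 G2 \<xi>G \<phi>G T0 T1 by (rule assms)
  show ?thesis
    using A.LN2 [OF assms(2,3)] A.F.mult_hom [OF assms(2,3)] A.G.mult_hom [OF assms(2,3)] LN2_iff [OF assms(2,3)]
    by blast
qed

lemma iso_square_mult:
  "\<lbrakk>f \<in> hom1 B X Y; g \<in> hom1 B Y Z\<rbrakk>
    \<Longrightarrow> F.target.iso_square (T0 X) (T0 Z) (F.target.square_comp (T0 X) (T0 Y) (T0 Z) (sq g) (sq f))"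
  by (rule F.target.iso_square_comp [OF iso_square_sq iso_square_sq])

text \<open>LN1 and LN2 place the unit and the multiplication over those of \<open>G\<close>,
  whatever the 2-cell maps are; \<open>F2\<close> and \<open>F2'\<close> may therefore be different
  variables here.\<close>

lemma laxFunc_unique:
  assumes "laxFunc_lax_transformation B D F0 F1 F2 \<xi>F \<phi>F G0 G1 G2 \<xi>G \<phi>G T0 T1"
    "laxFunc_lax_transformation B D F0 F1 F2' \<xi>F' \<phi>F' G0 G1 G2 \<xi>G \<phi>G T0 T1"
  shows "same_unit B \<xi>F \<xi>F'" "same_mult B \<phi>F \<phi>F'"
proof -
  show "same_unit B \<xi>F \<xi>F'"
    unfolding same_unit_def
  proof
    fix X assume X: "X \<in> Obj B"
    show "\<xi>F X = \<xi>F' X"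
      by (rule cell_over_unique [OF X X F.target.iso_square_id
            laxFunc_cell_over_unit [OF assms(1) X] laxFunc_cell_over_unit [OF assms(2) X]])
        (use X in simp)
  qed
  show "same_mult B \<phi>F \<phi>F'"
    unfolding same_mult_def
  proof (intro allI ballI)
    fix X Y Z f g assume f: "f \<in> hom1 B X Y" and g: "g \<in> hom1 B Y Z"
    show "\<phi>F f g = \<phi>F' f g"
      by (rule cell_over_unique [OF _ _ iso_square_mult [OF f g]
            laxFunc_cell_over_mult [OF assms(1) f g] laxFunc_cell_over_mult [OF assms(2) f g]])
        (use hom1_Obj [OF f] hom1_Obj [OF g] in auto)
  qed
qed

text \<open>The cells \<open>\<xi>F X\<close> and \<open>\<phi>F f g\<close> run between invertible
  squares and lie over invertible cells, so \<open>cell_over_iso\<close> applies.\<close>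

lemma laxFunc_pseudofunctor:
  assumes "laxFunc_lax_transformation B D F0 F1 F2 \<xi>F \<phi>F G0 G1 G2 \<xi>G \<phi>G T0 T1"
    "pseudofunctor B D G0 G1 G2 \<xi>G \<phi>G"
  shows "pseudofunctor B D F0 F1 F2 \<xi>F \<phi>F"
proof -
  interpret A: laxFunc_lax_transformation B D F0 F1 F2 \<xi>F \<phi>F G0 G1 G2 \<xi>G \<phi>G T0 T1 by (rule assms)
  interpret G: pseudofunctor B D G0 G1 G2 \<xi>G \<phi>G by (rule assms)
  show ?thesis
  proof
    fix X assume X: "X \<in> Obj B"
    have "F.target.iso_cell (\<xi>F X)"
      by (rule cell_over_iso [OF X X F.target.iso_square_id iso_square_sq [OF F.source.id1_hom [OF X]]
            laxFunc_cell_over_unit [OF assms(1) X]])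
        (use X G.unit_iso [OF X] in \<open>auto simp: F.target.iso2_iff\<close>)
    then show "\<xi>F X \<in> iso2 D (\<one> (F0 X)) (F1 (\<one>\<^bsub>B\<^esub> X))"
      using A.F.unit_hom [OF X] by (simp add: F.target.iso2_iff F.target.hom2_iff)
  next
    fix f g X Y Z assume f: "f \<in> hom1 B X Y" and g: "g \<in> hom1 B Y Z"
    have "F.target.iso_cell (\<phi>F f g)"
      by (rule cell_over_iso [OF _ _ iso_square_mult [OF f g] iso_square_sq [OF F.source.comp1_hom [OF f g]]
            laxFunc_cell_over_mult [OF assms(1) f g]])
        (use hom1_Obj [OF f] hom1_Obj [OF g] G.mult_iso [OF f g] in \<open>auto simp: F.target.iso2_iff\<close>)
    then show "\<phi>F f g \<in> iso2 D (F1 g \<star> F1 f) (F1 (g \<star>\<^bsub>B\<^esub> f))"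
      using A.F.mult_hom [OF f g] by (simp add: F.target.iso2_iff F.target.hom2_iff)
  qed
qed

text \<open>Lifts of the unit and the multiplication of \<open>G\<close> exist because identity
  squares and composites of invertible squares are invertible. LN1 and LN2 hold by this choice, and
  LN0 places \<open>F2\<close> over \<open>G2\<close> wherever an axiom applies
  \<open>F2\<close>.\<close>

lemma laxFunc_exists:
  assumes "Assg_lax_transformation B D F0 F1 F2 G0 G1 G2 T0 T1" "lax_functor B D G0 G1 G2 \<xi>G \<phi>G"
  shows "\<exists>\<xi>F \<phi>F. laxFunc_lax_transformation B D F0 F1 F2 \<xi>F \<phi>F G0 G1 G2 \<xi>G \<phi>G T0 T1"
proof -
  interpret A: Assg_lax_transformation B D F0 F1 F2 G0 G1 G2 T0 T1 by (rule assms)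
  interpret G: lax_functor B D G0 G1 G2 \<xi>G \<phi>G by (rule assms)
  note F2_over = Assg_cell_over [OF assms(1)]
  have "\<forall>X\<in>Obj B. \<exists>\<sigma>. cell_over X X (F.target.square_id (T0 X)) (sq (\<one>\<^bsub>B\<^esub> X)) (\<xi>G X) \<sigma>"
  proof
    fix X assume X: "X \<in> Obj B"
    show "\<exists>\<sigma>. cell_over X X (F.target.square_id (T0 X)) (sq (\<one>\<^bsub>B\<^esub> X)) (\<xi>G X) \<sigma>"
      by (rule cell_over_exists [OF X X F.target.iso_square_id square_sq [OF F.source.id1_hom [OF X]]])
        (use X G.unit_hom [OF X] in \<open>simp_all add: F.target.square_id_def\<close>)
  qed
  then obtain \<xi>F where unit_over:
    "\<And>X. X \<in> Obj B \<Longrightarrow> cell_over X X (F.target.square_id (T0 X)) (sq (\<one>\<^bsub>B\<^esub> X)) (\<xi>G X) (\<xi>F X)"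
    unfolding bchoice_iff by blast
  let ?comp = "\<lambda>f g. F.target.square_comp (T0 (src1 B f)) (T0 (trg1 B f)) (T0 (trg1 B g)) (sq g) (sq f)"
  \<comment> \<open>The choice is made on composable pairs; the chosen function is curried
    afterwards.\<close>
  have "\<forall>fg\<in>{(f, g). f \<in> Arr B \<and> g \<in> Arr B \<and> src1 B g = trg1 B f}. \<exists>\<sigma>.
      cell_over (src1 B (fst fg)) (trg1 B (snd fg)) (?comp (fst fg) (snd fg)) (sq (snd fg \<star>\<^bsub>B\<^esub> fst fg))
        (\<phi>G (fst fg) (snd fg)) \<sigma>"
  proof clarify
    fix f g assume "f \<in> Arr B" "g \<in> Arr B" "src1 B g = trg1 B f"
    then have f: "f \<in> hom1 B (src1 B f) (trg1 B f)" and g: "g \<in> hom1 B (trg1 B f) (trg1 B g)"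
      by (simp_all add: hom1_def)
    show "\<exists>\<sigma>. cell_over (src1 B (fst (f, g))) (trg1 B (snd (f, g))) (?comp (fst (f, g)) (snd (f, g)))
        (sq (snd (f, g) \<star>\<^bsub>B\<^esub> fst (f, g))) (\<phi>G (fst (f, g)) (snd (f, g))) \<sigma>"
      unfolding fst_conv snd_conv
      by (rule cell_over_exists [OF _ _ iso_square_mult [OF f g] square_sq [OF F.source.comp1_hom [OF f g]]])
        (use hom1_Obj [OF f] hom1_Obj [OF g] G.mult_hom [OF f g] in auto)
  qed
  then obtain \<phi>' where \<phi>': "\<And>f g. \<lbrakk>f \<in> Arr B; g \<in> Arr B; src1 B g = trg1 B f\<rbrakk> \<Longrightarrow>
      cell_over (src1 B f) (trg1 B g) (?comp f g) (sq (g \<star>\<^bsub>B\<^esub> f)) (\<phi>G f g) (\<phi>' (f, g))"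
    unfolding bchoice_iff by fastforce
  define \<phi>F where "\<phi>F = curry \<phi>'"
  have mult_over: "cell_over X Z (F.target.square_comp (T0 X) (T0 Y) (T0 Z) (sq g) (sq f)) (sq (g \<star>\<^bsub>B\<^esub> f))
      (\<phi>G f g) (\<phi>F f g)" if "f \<in> hom1 B X Y" "g \<in> hom1 B Y Z" for f g X Y Z
    using that \<phi>' [of f g] unfolding \<phi>F_def curry_def hom1_def by auto
  \<comment> \<open>Whiskering is horizontal composition with the identity cell on the square of
    \<open>g\<close>, which lies over the identity on \<open>G1 g\<close>.\<close>
  have whisker_left: "cell_over X Z (F.target.square_comp (T0 X) (T0 Y) (T0 Z) (sq g) P)
      (F.target.square_comp (T0 X) (T0 Y) (T0 Z) (sq g) P') (G1 g \<rhd> \<pi>) (F1 g \<rhd> \<sigma>)"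
    if "cell_over X Y P P' \<pi> \<sigma>" "g \<in> hom1 B Y Z" for X Y Z P P' \<pi> \<sigma> g
    using F.target.square_cell_hcomp [OF that(1) F.target.square_cell_id [OF square_sq [OF that(2)]]] by simp
  have whisker_right: "cell_over X Z (F.target.square_comp (T0 X) (T0 Y) (T0 Z) Q (sq f))
      (F.target.square_comp (T0 X) (T0 Y) (T0 Z) Q' (sq f)) (\<rho> \<lhd> G1 f) (\<tau> \<lhd> F1 f)"
    if "cell_over Y Z Q Q' \<rho> \<tau>" "f \<in> hom1 B X Y" for X Y Z Q Q' \<rho> \<tau> f
    using F.target.square_cell_hcomp [OF F.target.square_cell_id [OF square_sq [OF that(2)]] that(1)] by simp
  interpret F: lax_functor B D F0 F1 F2 \<xi>F \<phi>F
  proof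
    fix X assume X: "X \<in> Obj B"
    show "\<xi>F X \<in> hom2 D (\<one> (F0 X)) (F1 (\<one>\<^bsub>B\<^esub> X))"
      using unit_over [OF X] X by (simp add: F.target.square_id_def)
  next
    fix f g X Y Z assume f: "f \<in> hom1 B X Y" and g: "g \<in> hom1 B Y Z"
    show "\<phi>F f g \<in> hom2 D (F1 g \<star> F1 f) (F1 (g \<star>\<^bsub>B\<^esub> f))"
      using mult_over [OF f g] by simp
  next
    fix f g X Y Z f' g' \<alpha> \<beta>
    assume f: "f \<in> hom1 B X Y" and g: "g \<in> hom1 B Y Z" and \<alpha>: "\<alpha> \<in> hom2 B f f'" and \<beta>: "\<beta> \<in> hom2 B g g'"
    note f' = F.source.hom2_hom1 [OF \<alpha> f] and g' = F.source.hom2_hom1 [OF \<beta> g]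
    note gf = F.source.comp1_hom [OF f g] and \<beta>\<alpha> = F.source.hcomp_hom [OF f g \<alpha> \<beta>]
    \<comment> \<open>The left side lies over the left side of naturality for \<open>G\<close>;
      rewriting with \<open>G.mult_natural\<close> puts it over the same cell as the right
      side.\<close>
    show "\<phi>F f' g' \<cdot> (F2 \<beta> \<ast> F2 \<alpha>) = F2 (\<beta> \<ast>\<^bsub>B\<^esub> \<alpha>) \<cdot> \<phi>F f g"
      by (rule cell_over_unique [OF _ _ iso_square_mult [OF f g]
            F.target.square_cell_vcomp [OF F.target.square_cell_hcomp [OF F2_over [OF f \<alpha>] F2_over [OF g \<beta>]]
              mult_over [OF f' g'], unfolded G.mult_natural [OF f g \<alpha> \<beta>]]
            F.target.square_cell_vcomp [OF mult_over [OF f g] F2_over [OF gf \<beta>\<alpha>]]])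
        (use hom1_Obj [OF f] hom1_Obj [OF g] in auto)
  next
    fix f X Y assume f: "f \<in> hom1 B X Y"
    have X: "X \<in> Obj B" and Y: "Y \<in> Obj B" using hom1_Obj [OF f] by auto
    note one = F.source.id1_hom [OF X]
    have r: "\<r>\<^bsub>B\<^esub> f \<in> hom2 B (f \<star>\<^bsub>B\<^esub> \<one>\<^bsub>B\<^esub> X) f"
      using F.source.runit_iso [OF f] by (simp add: iso2_def)
    \<comment> \<open>The left side of the unit axiom is assembled factor by factor. Rewriting with
      \<open>G.unit_right\<close> puts it over \<open>\<r> (G1 f)\<close>, over which
      \<open>square_cell_runit\<close> places \<open>\<r> (F1 f)\<close>.\<close>
    note over = F.target.square_cell_vcomp [OF F.target.square_cell_vcomp [OF
          whisker_left [OF unit_over [OF X] f] mult_over [OF one f]]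
        F2_over [OF F.source.comp1_hom [OF one f] r]]
    show "F2 (\<r>\<^bsub>B\<^esub> f) \<cdot> \<phi>F (\<one>\<^bsub>B\<^esub> X) f \<cdot> (F1 f \<rhd> \<xi>F X) = \<r> (F1 f)"
      by (rule cell_over_unique [OF X Y F.target.iso_square_comp [OF F.target.iso_square_id iso_square_sq [OF f]]
            over [unfolded G.unit_right [OF f]]
            F.target.square_cell_runit [OF square_sq [OF f], unfolded fst_conv snd_conv]])
        (use X in simp)
  next
    fix f X Y assume f: "f \<in> hom1 B X Y"
    have X: "X \<in> Obj B" and Y: "Y \<in> Obj B" using hom1_Obj [OF f] by auto
    note one = F.source.id1_hom [OF Y]
    have l: "\<l>\<^bsub>B\<^esub> f \<in> hom2 B (\<one>\<^bsub>B\<^esub> Y \<star>\<^bsub>B\<^esub> f) f"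
      using F.source.lunit_iso [OF f] by (simp add: iso2_def)
    note over = F.target.square_cell_vcomp [OF F.target.square_cell_vcomp [OF
          whisker_right [OF unit_over [OF Y] f] mult_over [OF f one]]
        F2_over [OF F.source.comp1_hom [OF f one] l]]
    show "F2 (\<l>\<^bsub>B\<^esub> f) \<cdot> \<phi>F f (\<one>\<^bsub>B\<^esub> Y) \<cdot> (\<xi>F Y \<lhd> F1 f) = \<l> (F1 f)"
      by (rule cell_over_unique [OF X Y F.target.iso_square_comp [OF iso_square_sq [OF f] F.target.iso_square_id]
            over [unfolded G.unit_left [OF f]]
            F.target.square_cell_lunit [OF square_sq [OF f], unfolded fst_conv snd_conv]])
        (use Y in simp)
  next
    fix f g h W X Y Z assume f: "f \<in> hom1 B W X" and g: "g \<in> hom1 B X Y" and h: "h \<in> hom1 B Y Z"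
    note gf = F.source.comp1_hom [OF f g] and hg = F.source.comp1_hom [OF g h]
    have a: "\<a>\<^bsub>B\<^esub> h g f \<in> hom2 B ((h \<star>\<^bsub>B\<^esub> g) \<star>\<^bsub>B\<^esub> f) (h \<star>\<^bsub>B\<^esub> (g \<star>\<^bsub>B\<^esub> f))"
      using F.source.assoc_iso [OF f g h] by (simp add: iso2_def)
    note left = F.target.square_cell_vcomp [OF F.target.square_cell_vcomp [OF
          whisker_right [OF mult_over [OF g h] f] mult_over [OF f hg]]
        F2_over [OF F.source.comp1_hom [OF f hg] a]]
    \<comment> \<open>The first factor of the right side is an associator, which lies over the
      associator of the arrows of \<open>G\<close> by \<open>square_cell_assoc\<close>; the other
      two are multiplications, one of them whiskered.\<close>
    note right = F.target.square_cell_vcomp [OF F.target.square_cell_vcomp [OF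
          F.target.square_cell_assoc [OF square_sq [OF f] square_sq [OF g] square_sq [OF h], unfolded fst_conv snd_conv]
          whisker_left [OF mult_over [OF f g] h]] mult_over [OF gf h]]
    show "F2 (\<a>\<^bsub>B\<^esub> h g f) \<cdot> \<phi>F f (h \<star>\<^bsub>B\<^esub> g) \<cdot> (\<phi>F g h \<lhd> F1 f)
         = \<phi>F (g \<star>\<^bsub>B\<^esub> f) h \<cdot> (F1 h \<rhd> \<phi>F f g) \<cdot> \<a> (F1 h) (F1 g) (F1 f)"
      by (rule cell_over_unique [OF _ _ F.target.iso_square_comp [OF iso_square_sq [OF f] iso_square_mult [OF g h]]
            left [unfolded G.mult_assoc [OF f g h]] right])
        (use hom1_Obj [OF f] hom1_Obj [OF h] in auto)
  qed
  have "laxFunc_lax_transformation B D F0 F1 F2 \<xi>F \<phi>F G0 G1 G2 \<xi>G \<phi>G T0 T1"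
  proof
    fix X assume X: "X \<in> Obj B"
    show "(T0 X \<rhd> \<xi>F X) \<cdot> inv2 (\<r> (T0 X)) = T1 (\<one>\<^bsub>B\<^esub> X) \<cdot> (\<xi>G X \<lhd> T0 X) \<cdot> inv2 (\<l> (T0 X))"
      using unit_over [OF X] LN1_iff [OF X G.unit_hom [OF X] F.unit_hom [OF X]] by blast
  next
    fix f X Y g Z assume f: "f \<in> hom1 B X Y" and g: "g \<in> hom1 B Y Z"
    show "(T0 Z \<rhd> \<phi>F f g) \<cdot> \<a> (T0 Z) (F1 g) (F1 f) \<cdot> (T1 g \<lhd> F1 f)
           \<cdot> inv2 (\<a> (G1 g) (T0 Y) (F1 f)) \<cdot> (G1 g \<rhd> T1 f) \<cdot> \<a> (G1 g) (G1 f) (T0 X)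
         = T1 (g \<star>\<^bsub>B\<^esub> f) \<cdot> (\<phi>G f g \<lhd> T0 X)"
      using mult_over [OF f g] LN2_iff [OF f g G.mult_hom [OF f g] F.mult_hom [OF f g]] by blast
  qed
  then show ?thesis by blast
qed

end

section \<open>Transfer data at the different levels of structure\<close>

lemma preAssg_transfer_datum_iff:
  "preAssg_transfer_datum B D F0 F1 G0 G1 T0 T1 \<longleftrightarrow> transfer_datum B D F0 F1 G0 G1 T0 T1"
  by (auto simp: preAssg_transfer_datum_def preAssg_pseudo_transformation_def transfer_datum_def transfer_datum_axioms_def)

text \<open>Invertibility and the transfer condition concern only the preassignments and \<theta>,
  so once they are known the levels differ by the lax axioms alone.\<close>

lemma transfer_Assg_datum_iff:
  assumes "transfer_datum B D F0 F1 G0 G1 T0 T1"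
  shows "Assg_transfer_datum B D F0 F1 F2 G0 G1 G2 T0 T1 \<longleftrightarrow> Assg_lax_transformation B D F0 F1 F2 G0 G1 G2 T0 T1"
    and "laxFunc_pseudo_transformation B D F0 F1 F2 \<xi>F \<phi>F G0 G1 G2 \<xi>G \<phi>G T0 T1
      \<longleftrightarrow> laxFunc_lax_transformation B D F0 F1 F2 \<xi>F \<phi>F G0 G1 G2 \<xi>G \<phi>G T0 T1"
    and "laxFunc_transfer_datum B D F0 F1 F2 \<xi>F \<phi>F G0 G1 G2 \<xi>G \<phi>G T0 T1
      \<longleftrightarrow> laxFunc_lax_transformation B D F0 F1 F2 \<xi>F \<phi>F G0 G1 G2 \<xi>G \<phi>G T0 T1"
  using assms
  by (auto simp: transfer_datum_def transfer_datum_axioms_def Assg_transfer_datum_def Assg_pseudo_transformation_def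
      laxFunc_transfer_datum_def laxFunc_pseudo_transformation_def)

lemma Assg_transfer_datum_imp:
  assumes "Assg_transfer_datum B D F0 F1 F2 G0 G1 G2 T0 T1"
  shows "transfer_datum B D F0 F1 G0 G1 T0 T1"
  using assms
  by (auto simp: transfer_datum_def transfer_datum_axioms_def Assg_transfer_datum_def Assg_pseudo_transformation_def
      Assg_lax_transformation_def)

lemma Assg_assignment:
  "Assg_lax_transformation B D F0 F1 F2 G0 G1 G2 T0 T1 \<Longrightarrow> assignment B D F0 F1 F2"
  by (simp add: Assg_lax_transformation_def)

lemma laxFunc_lax_functor:
  "laxFunc_lax_transformation B D F0 F1 F2 \<xi>F \<phi>F G0 G1 G2 \<xi>G \<phi>G T0 T1 \<Longrightarrow> lax_functor B D F0 F1 F2 \<xi>F \<phi>F"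
  by (simp add: laxFunc_lax_transformation_def)

lemma laxFunc_Assg:
  "laxFunc_lax_transformation B D F0 F1 F2 \<xi>F \<phi>F G0 G1 G2 \<xi>G \<phi>G T0 T1
    \<Longrightarrow> Assg_lax_transformation B D F0 F1 F2 G0 G1 G2 T0 T1"
  by (simp add: laxFunc_lax_transformation_def)

theorem theoremA8:
  fixes B :: "('o, 'a, 'c) bicat" and D :: "('p, 'b, 'd) bicat"
    and F0 G0 :: "'o \<Rightarrow> 'p" and F1 G1 :: "'a \<Rightarrow> 'b"
    and T0 :: "'o \<Rightarrow> 'b" and T1 :: "'a \<Rightarrow> 'd"
  assumes "bicategory B" and "bicategory D"
    and "preassignment B D F0 F1" and "preassignment B D G0 G1"
  shows
   "(preAssg_transfer_datum B D F0 F1 G0 G1 T0 T1 \<longrightarrow>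
      (\<forall>G2. assignment B D G0 G1 G2 \<longrightarrow>
        (\<exists>F2. assignment B D F0 F1 F2 \<and>
              Assg_transfer_datum B D F0 F1 F2 G0 G1 G2 T0 T1 \<and>
              (\<forall>F2'. assignment B D F0 F1 F2' \<and>
                     Assg_transfer_datum B D F0 F1 F2' G0 G1 G2 T0 T1 \<longrightarrow>
                     same_cell_map B F2' F2))))
  \<and> (\<forall>F2 G2. assignment B D F0 F1 F2 \<and> assignment B D G0 G1 G2 \<and>
             Assg_transfer_datum B D F0 F1 F2 G0 G1 G2 T0 T1 \<longrightarrow>
      (\<forall>\<xi>G \<phi>G. lax_functor B D G0 G1 G2 \<xi>G \<phi>G \<longrightarrow>
        (\<exists>\<xi>F \<phi>F. lax_functor B D F0 F1 F2 \<xi>F \<phi>F \<and>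
              laxFunc_pseudo_transformation B D F0 F1 F2 \<xi>F \<phi>F G0 G1 G2 \<xi>G \<phi>G T0 T1 \<and>
              (\<forall>\<xi>F' \<phi>F'. lax_functor B D F0 F1 F2 \<xi>F' \<phi>F' \<and>
                     laxFunc_pseudo_transformation B D F0 F1 F2 \<xi>F' \<phi>F' G0 G1 G2 \<xi>G \<phi>G T0 T1 \<longrightarrow>
                     same_unit B \<xi>F' \<xi>F \<and> same_mult B \<phi>F' \<phi>F)))
      \<and>
      (\<forall>\<xi>G \<phi>G. pseudofunctor B D G0 G1 G2 \<xi>G \<phi>G \<longrightarrow>
        (\<exists>\<xi>F \<phi>F. pseudofunctor B D F0 F1 F2 \<xi>F \<phi>F \<and>
              laxFunc_pseudo_transformation B D F0 F1 F2 \<xi>F \<phi>F G0 G1 G2 \<xi>G \<phi>G T0 T1 \<and>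
              (\<forall>\<xi>F' \<phi>F'. pseudofunctor B D F0 F1 F2 \<xi>F' \<phi>F' \<and>
                     laxFunc_pseudo_transformation B D F0 F1 F2 \<xi>F' \<phi>F' G0 G1 G2 \<xi>G \<phi>G T0 T1 \<longrightarrow>
                     same_unit B \<xi>F' \<xi>F \<and> same_mult B \<phi>F' \<phi>F))))
  \<and> (preAssg_transfer_datum B D F0 F1 G0 G1 T0 T1 \<longrightarrow>
      (\<forall>G2 \<xi>G \<phi>G. lax_functor B D G0 G1 G2 \<xi>G \<phi>G \<longrightarrow>
        (\<exists>F2 \<xi>F \<phi>F. lax_functor B D F0 F1 F2 \<xi>F \<phi>F \<and>
              laxFunc_transfer_datum B D F0 F1 F2 \<xi>F \<phi>F G0 G1 G2 \<xi>G \<phi>G T0 T1 \<and>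
              (\<forall>F2' \<xi>F' \<phi>F'. lax_functor B D F0 F1 F2' \<xi>F' \<phi>F' \<and>
                     laxFunc_transfer_datum B D F0 F1 F2' \<xi>F' \<phi>F' G0 G1 G2 \<xi>G \<phi>G T0 T1 \<longrightarrow>
                     same_cell_map B F2' F2 \<and> same_unit B \<xi>F' \<xi>F \<and> same_mult B \<phi>F' \<phi>F)))
      \<and>
      (\<forall>G2 \<xi>G \<phi>G. pseudofunctor B D G0 G1 G2 \<xi>G \<phi>G \<longrightarrow>
        (\<exists>F2 \<xi>F \<phi>F. pseudofunctor B D F0 F1 F2 \<xi>F \<phi>F \<and>
              psdFunc_transfer_datum B D F0 F1 F2 \<xi>F \<phi>F G0 G1 G2 \<xi>G \<phi>G T0 T1 \<and>
              (\<forall>F2' \<xi>F' \<phi>F'. pseudofunctor B D F0 F1 F2' \<xi>F' \<phi>F' \<and>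
                     psdFunc_transfer_datum B D F0 F1 F2' \<xi>F' \<phi>F' G0 G1 G2 \<xi>G \<phi>G T0 T1 \<longrightarrow>
                     same_cell_map B F2' F2 \<and> same_unit B \<xi>F' \<xi>F \<and> same_mult B \<phi>F' \<phi>F))))"
proof (intro conjI impI allI)
  fix G2 assume \<theta>: "preAssg_transfer_datum B D F0 F1 G0 G1 T0 T1" and G: "assignment B D G0 G1 G2"
  interpret transfer_datum B D F0 F1 G0 G1 T0 T1 using \<theta> by (simp add: preAssg_transfer_datum_iff)
  note iffs = transfer_Assg_datum_iff [OF transfer_datum_axioms]
  obtain F2 where F: "Assg_lax_transformation B D F0 F1 F2 G0 G1 G2 T0 T1"
    using Assg_exists [OF G] by blast
  show "\<exists>F2. assignment B D F0 F1 F2 \<and> Assg_transfer_datum B D F0 F1 F2 G0 G1 G2 T0 T1 \<and>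
      (\<forall>F2'. assignment B D F0 F1 F2' \<and> Assg_transfer_datum B D F0 F1 F2' G0 G1 G2 T0 T1
        \<longrightarrow> same_cell_map B F2' F2)"
    unfolding iffs using F Assg_assignment [OF F] Assg_unique [OF _ F] by blast
next
  fix F2 G2 \<xi>G \<phi>G
  assume \<theta>: "assignment B D F0 F1 F2 \<and> assignment B D G0 G1 G2 \<and>
      Assg_transfer_datum B D F0 F1 F2 G0 G1 G2 T0 T1"
  then interpret transfer_datum B D F0 F1 G0 G1 T0 T1 using Assg_transfer_datum_imp by blast
  note iffs = transfer_Assg_datum_iff [OF transfer_datum_axioms]
  have \<theta>: "Assg_lax_transformation B D F0 F1 F2 G0 G1 G2 T0 T1" using \<theta> by (simp add: iffs)
  {
    assume G: "lax_functor B D G0 G1 G2 \<xi>G \<phi>G"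
    obtain \<xi>F \<phi>F where F: "laxFunc_lax_transformation B D F0 F1 F2 \<xi>F \<phi>F G0 G1 G2 \<xi>G \<phi>G T0 T1"
      using laxFunc_exists [OF \<theta> G] by blast
    show "\<exists>\<xi>F \<phi>F. lax_functor B D F0 F1 F2 \<xi>F \<phi>F \<and>
        laxFunc_pseudo_transformation B D F0 F1 F2 \<xi>F \<phi>F G0 G1 G2 \<xi>G \<phi>G T0 T1 \<and>
        (\<forall>\<xi>F' \<phi>F'. lax_functor B D F0 F1 F2 \<xi>F' \<phi>F' \<and>
           laxFunc_pseudo_transformation B D F0 F1 F2 \<xi>F' \<phi>F' G0 G1 G2 \<xi>G \<phi>G T0 T1 \<longrightarrow>
           same_unit B \<xi>F' \<xi>F \<and> same_mult B \<phi>F' \<phi>F)"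
      unfolding iffs using F laxFunc_lax_functor [OF F] laxFunc_unique [OF _ F] by blast
  next
    assume G: "pseudofunctor B D G0 G1 G2 \<xi>G \<phi>G"
    then have "lax_functor B D G0 G1 G2 \<xi>G \<phi>G" by (simp add: pseudofunctor_def)
    \<comment> \<open>The structure is the one transferred from the underlying lax functor;
      invertibility is established afterwards by \<open>laxFunc_pseudofunctor\<close>.\<close>
    then obtain \<xi>F \<phi>F where F: "laxFunc_lax_transformation B D F0 F1 F2 \<xi>F \<phi>F G0 G1 G2 \<xi>G \<phi>G T0 T1"
      using laxFunc_exists [OF \<theta>] by blast
    show "\<exists>\<xi>F \<phi>F. pseudofunctor B D F0 F1 F2 \<xi>F \<phi>F \<and>
        laxFunc_pseudo_transformation B D F0 F1 F2 \<xi>F \<phi>F G0 G1 G2 \<xi>G \<phi>G T0 T1 \<and>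
        (\<forall>\<xi>F' \<phi>F'. pseudofunctor B D F0 F1 F2 \<xi>F' \<phi>F' \<and>
           laxFunc_pseudo_transformation B D F0 F1 F2 \<xi>F' \<phi>F' G0 G1 G2 \<xi>G \<phi>G T0 T1 \<longrightarrow>
           same_unit B \<xi>F' \<xi>F \<and> same_mult B \<phi>F' \<phi>F)"
      unfolding iffs using F laxFunc_pseudofunctor [OF F G] laxFunc_unique [OF _ F] by blast
  }
next
  fix G2 \<xi>G \<phi>G
  assume \<theta>: "preAssg_transfer_datum B D F0 F1 G0 G1 T0 T1" and G: "lax_functor B D G0 G1 G2 \<xi>G \<phi>G"
  interpret transfer_datum B D F0 F1 G0 G1 T0 T1 using \<theta> by (simp add: preAssg_transfer_datum_iff)
  note iffs = transfer_Assg_datum_iff [OF transfer_datum_axioms]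
  \<comment> \<open>The 2-cell map is transferred first, and the unit and the multiplication are
    then transferred relative to it.\<close>
  obtain F2 \<xi>F \<phi>F where F: "laxFunc_lax_transformation B D F0 F1 F2 \<xi>F \<phi>F G0 G1 G2 \<xi>G \<phi>G T0 T1"
    using Assg_exists laxFunc_exists [OF _ G] G by (meson lax_functor.axioms(1))
  show "\<exists>F2 \<xi>F \<phi>F. lax_functor B D F0 F1 F2 \<xi>F \<phi>F \<and>
      laxFunc_transfer_datum B D F0 F1 F2 \<xi>F \<phi>F G0 G1 G2 \<xi>G \<phi>G T0 T1 \<and>
      (\<forall>F2' \<xi>F' \<phi>F'. lax_functor B D F0 F1 F2' \<xi>F' \<phi>F' \<and>
         laxFunc_transfer_datum B D F0 F1 F2' \<xi>F' \<phi>F' G0 G1 G2 \<xi>G \<phi>G T0 T1 \<longrightarrow>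
         same_cell_map B F2' F2 \<and> same_unit B \<xi>F' \<xi>F \<and> same_mult B \<phi>F' \<phi>F)"
    \<comment> \<open>A competing structure brings its own 2-cell map; forgetting down to
      assignments shows that this map agrees with \<open>F2\<close>.\<close>
    unfolding iffs
    using F laxFunc_lax_functor [OF F] laxFunc_unique [OF _ F]
      Assg_unique [OF laxFunc_Assg laxFunc_Assg [OF F]] by blast
next
  fix G2 \<xi>G \<phi>G
  assume \<theta>: "preAssg_transfer_datum B D F0 F1 G0 G1 T0 T1" and G: "pseudofunctor B D G0 G1 G2 \<xi>G \<phi>G"
  interpret transfer_datum B D F0 F1 G0 G1 T0 T1 using \<theta> by (simp add: preAssg_transfer_datum_iff)
  note iffs = transfer_Assg_datum_iff [OF transfer_datum_axioms]
  have G': "lax_functor B D G0 G1 G2 \<xi>G \<phi>G" using G by (simp add: pseudofunctor_def)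
  obtain F2 \<xi>F \<phi>F where F: "laxFunc_lax_transformation B D F0 F1 F2 \<xi>F \<phi>F G0 G1 G2 \<xi>G \<phi>G T0 T1"
    using Assg_exists laxFunc_exists [OF _ G'] G' by (meson lax_functor.axioms(1))
  show "\<exists>F2 \<xi>F \<phi>F. pseudofunctor B D F0 F1 F2 \<xi>F \<phi>F \<and>
      psdFunc_transfer_datum B D F0 F1 F2 \<xi>F \<phi>F G0 G1 G2 \<xi>G \<phi>G T0 T1 \<and>
      (\<forall>F2' \<xi>F' \<phi>F'. pseudofunctor B D F0 F1 F2' \<xi>F' \<phi>F' \<and>
         psdFunc_transfer_datum B D F0 F1 F2' \<xi>F' \<phi>F' G0 G1 G2 \<xi>G \<phi>G T0 T1 \<longrightarrow>
         same_cell_map B F2' F2 \<and> same_unit B \<xi>F' \<xi>F \<and> same_mult B \<phi>F' \<phi>F)"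
    unfolding psdFunc_transfer_datum_def iffs
    using F G laxFunc_pseudofunctor [OF F G] laxFunc_unique [OF _ F]
      Assg_unique [OF laxFunc_Assg laxFunc_Assg [OF F]] by blast
qed

end
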